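(* Let $\Delta$ be a pure two-dimensional simplicial complex on $n\ge 6$ vertices. Then $I_\Delta^{(3)}=I_\Delta^3$ if and only if one of the following conditions is satisfied: (i) $n=6$, $\overline{\Delta_1}$ has three pairwise disjoint edges and $\Delta_1$ has two disjoint triangles; (ii) $n=7$ and, up to a permutation of the variables, $I_\Delta=(x_1x_2,\,x_2x_3,\,x_3x_4,\,x_4x_5,\,x_5x_6,\,x_6x_7,\,x_7x_1)$.
   Context: Let $K$ be a field and $R=K[x_1,\dots,x_n]$. A simplicial complex $\Delta$ on the vertex set $[n]=\{1,\dots,n\}$ is assumed to satisfy $\{i\}\in\Delta$ for every $i\in[n]$. A facet is a maximal face; $\mathcal F(\Delta)$ is the set of facets; $\Delta$ is pure if all facets have the same dimension. The Stanley-Reisner ideal is $I_\Delta=(x_{i_1}\cdots x_{i_s} : \{i_1,\dots,i_s\}\notin\Delta)$. The $m$-th symbolic power is $I_\Delta^{(m)}=\bigcap_{F\in\mathcal F(\Delta)}P_F^m$, where $P_F=(x_i : i\notin F)$. $\Delta_1$ denotes the graph on $[n]$ whose edges are the two-element faces of $\Delta$, and $\overline{\Delta_1}$ is its complement graph on $[n]$. A triangle of $\Delta_1$ is a set of three pairwise adjacent vertices of $\Delta_1$ (it need not be a face of $\Delta$). Disjoint means having no common vertex. *)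

theory Defs
  imports Complex_Main "HOL-Library.Poly_Mapping" "HOL-Library.Cardinality"
begin

text \<open>The ideals of a commutative ring are the submodules of the ring regarded as a module over
  itself, so the ideal generated by a set \<open>S\<close> is \<open>ideal.span S\<close>.\<close>

global_interpretation ideal: module "(*) :: 'a::comm_ring_1 \<Rightarrow> 'a \<Rightarrow> 'a"
  by unfold_locales (simp_all add: algebra_simps)

definition ideal_mult :: "'a::comm_ring_1 set \<Rightarrow> 'a set \<Rightarrow> 'a set" where
  "ideal_mult I J = ideal.span {a * b | a b. a \<in> I \<and> b \<in> J}"

primrec ideal_power :: "'a::comm_ring_1 set \<Rightarrow> nat \<Rightarrow> 'a set" where
  "ideal_power I 0 = UNIV"
| "ideal_power I (Suc m) = ideal_mult I (ideal_power I m)"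

text \<open>The finite type \<open>'v\<close> plays the role of the vertex set \<open>[n]\<close>, with \<open>n = CARD('v)\<close>.  The
  polynomial ring \<open>K[x\<^sub>v | v \<in> 'v]\<close> consists of the finitely supported functions
  from exponent vectors to \<open>K\<close>, with the convolution product.\<close>

type_synonym ('v, 'k) mpoly = "('v \<Rightarrow>\<^sub>0 nat) \<Rightarrow>\<^sub>0 'k"

definition var :: "'v \<Rightarrow> ('v, 'k::field) mpoly" where
  "var v = Poly_Mapping.single (Poly_Mapping.single v 1) 1"

definition simplicial_complex :: "'v set set \<Rightarrow> bool" where
  "simplicial_complex \<Delta> \<longleftrightarrow> (\<forall>F\<in>\<Delta>. \<forall>G. G \<subseteq> F \<longrightarrow> G \<in> \<Delta>) \<and> (\<forall>v. {v} \<in> \<Delta>)"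

definition facets :: "'v set set \<Rightarrow> 'v set set" where
  "facets \<Delta> = {F \<in> \<Delta>. \<forall>G\<in>\<Delta>. F \<subseteq> G \<longrightarrow> G = F}"

definition face_dim :: "'v set \<Rightarrow> int" where
  "face_dim F = int (card F) - 1"

definition complex_dim :: "'v::finite set set \<Rightarrow> int" where
  "complex_dim \<Delta> = Max (face_dim ` \<Delta>)"

definition pure_complex :: "'v set set \<Rightarrow> bool" where
  "pure_complex \<Delta> \<longleftrightarrow> (\<forall>F\<in>facets \<Delta>. \<forall>G\<in>facets \<Delta>. face_dim F = face_dim G)"

definition stanley_reisner_ideal :: "'v::finite set set \<Rightarrow> ('v, 'k::field) mpoly set" where
  "stanley_reisner_ideal \<Delta> = ideal.span {\<Prod>v\<in>S. var v | S. S \<notin> \<Delta>}"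

definition face_prime :: "'v::finite set \<Rightarrow> ('v, 'k::field) mpoly set" where
  "face_prime F = ideal.span {var v | v. v \<notin> F}"

text \<open>The \<open>m\<close>-th symbolic power of the Stanley-Reisner ideal of \<open>\<Delta>\<close>, which depends only on the
  facets of \<open>\<Delta>\<close>.\<close>

definition symbolic_power :: "'v::finite set set \<Rightarrow> nat \<Rightarrow> ('v, 'k::field) mpoly set" where
  "symbolic_power \<Delta> m = (\<Inter>F\<in>facets \<Delta>. ideal_power (face_prime F) m)"

text \<open>Graphs on the vertex set \<open>UNIV\<close> are given by their sets of two-element edges.  The vertices of
  a triangle need not span a face of \<open>\<Delta>\<close>.\<close>

definition one_skeleton :: "'v set set \<Rightarrow> 'v set set" where
  "one_skeleton \<Delta> = {e \<in> \<Delta>. card e = 2}"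

definition complement_graph :: "'v set set \<Rightarrow> 'v set set" where
  "complement_graph E = {e. card e = 2 \<and> e \<notin> E}"

definition triangles :: "'v set set \<Rightarrow> 'v set set" where
  "triangles E = {T. card T = 3 \<and> (\<forall>u\<in>T. \<forall>v\<in>T. u \<noteq> v \<longrightarrow> {u, v} \<in> E)}"

end

theory Submission
  imports Defs
begin

text \<open>Membership in powers and symbolic powers is decided monomial by monomial.  The equality therefore says
  that every weight \<open>a\<close> on the vertices whose restriction to the complement of each face has total at least \<open>3\<close>
  dominates the sum of the indicators of three nonfaces.

  Let \<open>G\<close> be the complement of the graph of \<open>\<Delta>\<close>.  Weights of total at most \<open>6\<close> can only be decomposed into
  edges of \<open>G\<close>.  The weights \<open>1\<close> on six vertices, \<open>2, 2, 1\<close> on three vertices and \<open>1\<close> on five vertices show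
  that every six vertices carry a perfect matching of \<open>G\<close>, and that \<open>G\<close> has neither triangles nor pentagons.  If
  \<open>n = 6\<close>, then \<open>G\<close> is bipartite with a perfect matching.  If \<open>n \<ge> 7\<close>, then every vertex has at most four
  non-neighbours, and a vertex of degree three would lie on a pentagon, so \<open>n = 7\<close> and \<open>G\<close> is
  2-regular, hence a heptagon; the weight \<open>2\<close> at a vertex and \<open>1\<close> at four others excludes further minimal nonfaces.

  Conversely, a weight on the heptagon is either positive everywhere or lives on a path, and in the case \<open>n = 6\<close>
  the graph contains a spanning bipartite graph; both are handled by the weighted form of Koenig's theorem.\<close>

section \<open>Powers of squarefree monomial ideals\<close>

text \<open>For monotone \<open>P\<close> this is a monomial ideal. Describing such ideals by
  predicates on plain functions turns powers, intersections and equality into statements about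
  exponents.\<close>

definition exponent_ideal :: "(('v \<Rightarrow> nat) \<Rightarrow> bool) \<Rightarrow> ('v, 'k::field) mpoly set" where
  "exponent_ideal P = {p. \<forall>t\<in>Poly_Mapping.keys p. P (Poly_Mapping.lookup t)}"

lemma subspace_exponent_ideal:
  assumes "mono P"
  shows "ideal.subspace (exponent_ideal P :: ('v, 'k::field) mpoly set)"
proof (rule ideal.subspaceI)
  show "0 \<in> (exponent_ideal P :: ('v, 'k) mpoly set)"
    by (simp add: exponent_ideal_def)
next
  fix p q :: "('v, 'k) mpoly"
  assume "p \<in> exponent_ideal P" "q \<in> exponent_ideal P"
  then show "p + q \<in> exponent_ideal P"
    using Poly_Mapping.keys_add[of p q] by (auto simp: exponent_ideal_def)
next
  fix c p :: "('v, 'k) mpoly"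
  assume p: "p \<in> exponent_ideal P"
  show "c * p \<in> exponent_ideal P"
    unfolding exponent_ideal_def
  proof (intro CollectI ballI)
    fix t assume "t \<in> Poly_Mapping.keys (c * p)"
    then obtain r s where "t = r + s" "s \<in> Poly_Mapping.keys p"
      using keys_mult[of c p] by auto
    moreover have "Poly_Mapping.lookup s \<le> Poly_Mapping.lookup (r + s)"
      by (simp add: le_fun_def lookup_add)
    ultimately show "P (Poly_Mapping.lookup t)"
      using p monoD[OF assms] by (auto simp: exponent_ideal_def)
  qed
qed

lemma mpoly_sum_monomials:
  fixes p :: "('v, 'k::field) mpoly"
  shows "p = (\<Sum>t\<in>Poly_Mapping.keys p. Poly_Mapping.single t (Poly_Mapping.lookup p t))"
  by (rule poly_mapping_eqI) (auto simp: lookup_sum lookup_single when_def in_keys_iff)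

lemma exponent_ideal_subset_span:
  fixes X :: "('v, 'k::field) mpoly set"
  assumes "\<And>t c. P (Poly_Mapping.lookup t) \<Longrightarrow> Poly_Mapping.single t c \<in> ideal.span X"
  shows "exponent_ideal P \<subseteq> ideal.span X"
proof
  fix p :: "('v, 'k) mpoly"
  assume "p \<in> exponent_ideal P"
  then have "(\<Sum>t\<in>Poly_Mapping.keys p. Poly_Mapping.single t (Poly_Mapping.lookup p t)) \<in> ideal.span X"
    by (intro ideal.span_sum assms) (simp add: exponent_ideal_def)
  then show "p \<in> ideal.span X"
    using mpoly_sum_monomials[of p] by simp
qed

text \<open>Testing a single monomial with coefficient 1 recovers the predicate; as
  \<open>'v\<close> is finite, every function is the exponent vector of such a monomial.\<close>

lemma exponent_ideal_eq_iff:
  fixes P Q :: "('v::finite \<Rightarrow> nat) \<Rightarrow> bool"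
  shows "(exponent_ideal P :: ('v, 'k::field) mpoly set) = exponent_ideal Q \<longleftrightarrow> (\<forall>a. P a \<longleftrightarrow> Q a)"
proof
  assume eq: "(exponent_ideal P :: ('v, 'k) mpoly set) = exponent_ideal Q"
  have single: "Poly_Mapping.single (Abs_poly_mapping a) (1::'k) \<in> exponent_ideal R \<longleftrightarrow> R a"
    for a and R :: "('v \<Rightarrow> nat) \<Rightarrow> bool"
    by (simp add: exponent_ideal_def Abs_poly_mapping_inverse)
  show "\<forall>a. P a \<longleftrightarrow> Q a"
    using single[of _ P] single[of _ Q] eq by blast
qed (simp add: exponent_ideal_def)

definition squarefree_ideal :: "'v set set \<Rightarrow> ('v, 'k::field) mpoly set" where
  "squarefree_ideal N = ideal.span {\<Prod>v\<in>S. var v | S. S \<in> N}"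

lemma squarefree_monomial:
  fixes S :: "'v::finite set"
  obtains s :: "'v \<Rightarrow>\<^sub>0 nat"
    where "(\<Prod>v\<in>S. var v) = Poly_Mapping.single s (1::'k::field)"
      and "\<And>v. Poly_Mapping.lookup s v = of_bool (v \<in> S)"
proof
  show "(\<Prod>v\<in>S. var v) = Poly_Mapping.single (\<Sum>v\<in>S. Poly_Mapping.single v 1) (1::'k)"
    using finite[of S] by (induction S) (auto simp: var_def mult_single)
  show "Poly_Mapping.lookup (\<Sum>v\<in>S. Poly_Mapping.single v 1) u = of_bool (u \<in> S)" for u
    by (auto simp: lookup_sum lookup_single when_def)
qed

text \<open>\<open>packs N m a\<close> means that \<open>x\<^sup>a\<close> is divisible by a product of \<open>m\<close> squarefree monomials with
  supports in \<open>N\<close>.\<close>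

primrec packs :: "'v set set \<Rightarrow> nat \<Rightarrow> ('v \<Rightarrow> nat) \<Rightarrow> bool" where
  "packs N 0 a \<longleftrightarrow> True"
| "packs N (Suc m) a \<longleftrightarrow> (\<exists>S\<in>N. (\<forall>v\<in>S. 0 < a v) \<and> packs N m (\<lambda>v. a v - of_bool (v \<in> S)))"

lemma positive_on_mono:
  fixes a b :: "'v \<Rightarrow> nat"
  assumes "\<forall>v\<in>S. 0 < a v" "a \<le> b"
  shows "\<forall>v\<in>S. 0 < b v"
  using assms by (meson le_funD order.strict_trans2)

lemma packs_mono:
  assumes "packs N m a" "a \<le> b"
  shows "packs N m b"
  using assms
proof (induction m arbitrary: a b)
  case (Suc m)
  then obtain S where S: "S \<in> N" "\<forall>v\<in>S. 0 < a v" "packs N m (\<lambda>v. a v - of_bool (v \<in> S))"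
    by auto
  have "packs N m (\<lambda>v. b v - of_bool (v \<in> S))"
    using Suc.IH[OF S(3)] Suc.prems(2) by (auto simp: le_fun_def diff_le_mono)
  moreover have "\<forall>v\<in>S. 0 < b v"
    using positive_on_mono[OF S(2) Suc.prems(2)] .
  ultimately show ?case
    unfolding packs.simps using S(1) by blast
qed simp

lemma mono_packs: "mono (packs N m)"
  by (intro monoI le_boolI) (rule packs_mono)

text \<open>Exponents of \<open>f * g\<close> are sums of exponents of the factors, and one from
  \<open>f\<close> dominates the indicator of some \<open>S\<close>. Conversely, a monomial
  dominating that indicator is divisible by the product over \<open>S\<close>, and the cofactor
  satisfies \<open>P\<close>.\<close>

lemma ideal_mult_squarefree_ideal:
  fixes P :: "('v::finite \<Rightarrow> nat) \<Rightarrow> bool"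
  assumes "mono P"
  shows "ideal_mult (squarefree_ideal N) (exponent_ideal P) =
    (exponent_ideal (\<lambda>a. \<exists>S\<in>N. (\<forall>v\<in>S. 0 < a v) \<and> P (\<lambda>v. a v - of_bool (v \<in> S)))
      :: ('v, 'k::field) mpoly set)" (is "_ = exponent_ideal ?Q")
proof (rule antisym)
  have P: "P b" if "P a" "a \<le> b" for a b
    using monoD[OF assms that(2)] that(1) by simp
  let ?D = "\<lambda>a :: 'v \<Rightarrow> nat. \<exists>S\<in>N. \<forall>v\<in>S. 0 < a v"
  have "mono ?D"
    by (intro monoI le_boolI) (elim bexE, rule bexI, rule positive_on_mono)
  \<comment> \<open>Only this inclusion is at hand; the equality \<open>squarefree_ideal_eq\<close>
    is derived from the present lemma.\<close>
  then have D: "squarefree_ideal N \<subseteq> (exponent_ideal ?D :: ('v, 'k) mpoly set)"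
    unfolding squarefree_ideal_def
  proof (intro ideal.span_minimal subspace_exponent_ideal subsetI)
    fix p :: "('v, 'k) mpoly"
    assume "p \<in> {\<Prod>v\<in>S. var v | S. S \<in> N}"
    then obtain S where S: "S \<in> N" "p = (\<Prod>v\<in>S. var v)" by auto
    obtain s where s: "(\<Prod>v\<in>S. var v) = Poly_Mapping.single s (1::'k)"
      "\<And>v. Poly_Mapping.lookup s v = of_bool (v \<in> S)"
      by (rule squarefree_monomial) blast
    show "p \<in> exponent_ideal ?D"
      using S by (auto simp: exponent_ideal_def s)
  qed
  have mono: "mono ?Q"
  proof (intro monoI le_boolI)
    fix a b :: "'v \<Rightarrow> nat"
    assume "a \<le> b" "?Q a"
    then obtain S where S: "S \<in> N" "\<forall>v\<in>S. 0 < a v" "P (\<lambda>v. a v - of_bool (v \<in> S))" by auto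
    have "(\<lambda>v. a v - of_bool (v \<in> S)) \<le> (\<lambda>v. b v - of_bool (v \<in> S))"
      using \<open>a \<le> b\<close> by (auto simp: le_fun_def diff_le_mono)
    then have "P (\<lambda>v. b v - of_bool (v \<in> S))"
      using P S(3) by blast
    moreover have "\<forall>v\<in>S. 0 < b v"
      using positive_on_mono[OF S(2) \<open>a \<le> b\<close>] .
    ultimately show "?Q b" using S(1) by blast
  qed
  show "ideal_mult (squarefree_ideal N) (exponent_ideal P) \<subseteq>
    (exponent_ideal ?Q :: ('v, 'k) mpoly set)"
    unfolding ideal_mult_def
  proof (intro ideal.span_minimal subspace_exponent_ideal[OF mono] subsetI)
    fix p :: "('v, 'k) mpoly"
    assume "p \<in> {f * g | f g. f \<in> squarefree_ideal N \<and> g \<in> exponent_ideal P}"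
    then obtain f g where p: "p = f * g" and f: "f \<in> exponent_ideal ?D" and g: "g \<in> exponent_ideal P"
      using D by auto
    show "p \<in> exponent_ideal ?Q"
      unfolding exponent_ideal_def
    proof (intro CollectI ballI)
      fix t assume "t \<in> Poly_Mapping.keys p"
      then obtain r s where t: "t = r + s" "r \<in> Poly_Mapping.keys f" "s \<in> Poly_Mapping.keys g"
        using keys_mult[of f g] p by auto
      obtain S where S: "S \<in> N" "\<forall>v\<in>S. 0 < Poly_Mapping.lookup r v"
        using f t(2) by (auto simp: exponent_ideal_def)
      have "Poly_Mapping.lookup s \<le> (\<lambda>v. Poly_Mapping.lookup t v - of_bool (v \<in> S))"
        using S(2) by (auto simp: t(1) le_fun_def lookup_add)
      then have "P (\<lambda>v. Poly_Mapping.lookup t v - of_bool (v \<in> S))"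
        using P g t(3) unfolding exponent_ideal_def by blast
      moreover have "\<forall>v\<in>S. 0 < Poly_Mapping.lookup t v"
        using S(2) by (auto simp: t(1) lookup_add)
      ultimately show "?Q (Poly_Mapping.lookup t)" using S(1) by blast
    qed
  qed
  show "exponent_ideal ?Q \<subseteq>
    (ideal_mult (squarefree_ideal N) (exponent_ideal P) :: ('v, 'k) mpoly set)"
    unfolding ideal_mult_def
  proof (rule exponent_ideal_subset_span)
    fix t and c :: 'k
    assume "?Q (Poly_Mapping.lookup t)"
    then obtain S where S: "S \<in> N" "\<forall>v\<in>S. 0 < Poly_Mapping.lookup t v" "P (\<lambda>v. Poly_Mapping.lookup t v - of_bool (v \<in> S))"
      by auto
    obtain s where s: "(\<Prod>v\<in>S. var v) = Poly_Mapping.single s (1::'k)"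
      "\<And>v. Poly_Mapping.lookup s v = of_bool (v \<in> S)"
      by (rule squarefree_monomial) blast
    define r where "r = t - s"
    have r: "Poly_Mapping.lookup r = (\<lambda>v. Poly_Mapping.lookup t v - of_bool (v \<in> S))"
      by (auto simp: r_def s lookup_minus)
    \<comment> \<open>Subtraction of exponents is truncated; it is exact here because
      \<open>t\<close> is positive on \<open>S\<close>.\<close>
    have "s + r = t"
      using S(2) by (intro poly_mapping_eqI) (auto simp: lookup_add r s(2) Suc_leI)
    then have eq: "Poly_Mapping.single t c = (\<Prod>v\<in>S. var v) * Poly_Mapping.single r c"
      by (simp add: s(1) mult_single)
    have "(\<Prod>v\<in>S. var v) \<in> (squarefree_ideal N :: ('v, 'k) mpoly set)"
      using S(1) by (auto simp: squarefree_ideal_def intro!: ideal.span_base)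
    moreover have "Poly_Mapping.single r c \<in> exponent_ideal P"
      using S(3) by (simp add: exponent_ideal_def r)
    ultimately show "Poly_Mapping.single t c \<in>
      ideal.span {f * g | f g. f \<in> squarefree_ideal N \<and> g \<in> exponent_ideal P}"
      unfolding eq by (intro ideal.span_base) blast
  qed
qed

lemma ideal_power_squarefree_ideal:
  fixes N :: "'v::finite set set"
  shows "ideal_power (squarefree_ideal N) m = (exponent_ideal (packs N m) :: ('v, 'k::field) mpoly set)"
proof (induction m)
  case 0
  then show ?case by (simp add: exponent_ideal_def)
next
  case (Suc m)
  then show ?case
    using ideal_mult_squarefree_ideal[OF mono_packs[of N m], of N] by (simp add: exponent_ideal_def)
qed

text \<open>This is the power formula for exponent 1: \<open>ideal_power I 1\<close> is
  \<open>I\<close> times the whole ring, which returns any ideal \<open>I\<close>.\<close>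

lemma squarefree_ideal_eq:
  fixes N :: "'v::finite set set"
  shows "squarefree_ideal N = (exponent_ideal (\<lambda>a. \<exists>S\<in>N. \<forall>v\<in>S. 0 < a v) :: ('v, 'k::field) mpoly set)"
proof -
  have "ideal_mult I UNIV = I" if I: "ideal.subspace I" for I :: "('v, 'k) mpoly set"
  proof
    show "ideal_mult I UNIV \<subseteq> I"
      unfolding ideal_mult_def
    proof (intro ideal.span_minimal I subsetI)
      fix p assume "p \<in> {a * b | a b. a \<in> I \<and> b \<in> UNIV}"
      then obtain a b where "p = b * a" "a \<in> I" by (auto simp: mult.commute)
      then show "p \<in> I" using ideal.subspace_scale[OF I] by auto
    qed
    show "I \<subseteq> ideal_mult I UNIV"
      unfolding ideal_mult_def
      by (intro subsetI ideal.span_base CollectI) (metis UNIV_I mult.right_neutral)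
  qed
  then have "squarefree_ideal N = (ideal_power (squarefree_ideal N) 1 :: ('v, 'k) mpoly set)"
    by (simp add: squarefree_ideal_def)
  then show ?thesis
    by (simp add: ideal_power_squarefree_ideal del: ideal_power.simps) (simp add: exponent_ideal_def)
qed

text \<open>With \<open>A = - F\<close> this turns membership in a power of
  \<open>face_prime F\<close> into a linear inequality. Each removal lowers the total on
  \<open>A\<close> by exactly one, so any positive vertex of \<open>A\<close> may come
  first.\<close>

lemma packs_singletons_iff:
  fixes A :: "'v::finite set"
  shows "packs {{v} | v. v \<in> A} m a \<longleftrightarrow> m \<le> sum a A"
proof (induction m arbitrary: a)
  case (Suc m)
  have *: "Suc (\<Sum>u\<in>A. a u - of_bool (u = v)) = sum a A" if "v \<in> A" "0 < a v" for v
  proof -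
    have "sum a A = a v + sum a (A - {v})"
      using that(1) by (simp add: sum.remove)
    moreover have "(\<Sum>u\<in>A. a u - of_bool (u = v)) = (a v - 1) + (\<Sum>u\<in>A - {v}. a u - of_bool (u = v))"
      using that(1) by (simp add: sum.remove)
    moreover have "(\<Sum>u\<in>A - {v}. a u - of_bool (u = v)) = sum a (A - {v})"
      by (intro sum.cong) auto
    ultimately show ?thesis using that(2) by simp
  qed
  have "packs {{v} | v. v \<in> A} (Suc m) a \<longleftrightarrow>
    (\<exists>v\<in>A. 0 < a v \<and> m \<le> (\<Sum>u\<in>A. a u - of_bool (u = v)))"
    unfolding packs.simps Suc.IH by (simp add: setcompr_eq_image image_image Bex_def)
  also have "\<dots> \<longleftrightarrow> (\<exists>v\<in>A. 0 < a v) \<and> Suc m \<le> sum a A"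
    using * by force
  also have "\<dots> \<longleftrightarrow> Suc m \<le> sum a A"
    using sum_eq_0_iff[of A a] by fastforce
  finally show ?case .
qed simp

text \<open>Intersections of exponent ideals correspond to conjunctions of predicates, so both sides
  are exponent ideals and can be compared at each \<open>a\<close>.\<close>

lemma symbolic_power_eq_iff:
  fixes \<Delta> :: "'v::finite set set"
  shows "(symbolic_power \<Delta> m :: ('v, 'k::field) mpoly set) = ideal_power (stanley_reisner_ideal \<Delta>) m
    \<longleftrightarrow> (\<forall>a. (\<forall>F\<in>facets \<Delta>. m \<le> sum a (- F)) \<longleftrightarrow> packs (- \<Delta>) m a)"
proof -
  have "face_prime F = (squarefree_ideal {{v} | v. v \<in> - F} :: ('v, 'k) mpoly set)" for F :: "'v set"
    unfolding face_prime_def squarefree_ideal_def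
    by (rule arg_cong[of _ _ ideal.span]) force
  then have "(symbolic_power \<Delta> m :: ('v, 'k) mpoly set)
      = exponent_ideal (\<lambda>a. \<forall>F\<in>facets \<Delta>. m \<le> sum a (- F))"
    by (simp only: symbolic_power_def ideal_power_squarefree_ideal packs_singletons_iff
        exponent_ideal_def) auto
  moreover have "(stanley_reisner_ideal \<Delta> :: ('v, 'k) mpoly set) = squarefree_ideal (- \<Delta>)"
    by (simp add: stanley_reisner_ideal_def squarefree_ideal_def)
  ultimately show ?thesis
    by (simp only: ideal_power_squarefree_ideal exponent_ideal_eq_iff)
qed

text \<open>Whether a monomial lies in a squarefree monomial ideal depends only on its support, and
  indicator functions realise every set as a support. A support containing a nonface is itself a
  nonface.\<close>

lemma stanley_reisner_ideal_eq_iff: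
  fixes \<Delta> E :: "'v::finite set set"
  assumes subset_face: "\<And>F G. F \<in> \<Delta> \<Longrightarrow> G \<subseteq> F \<Longrightarrow> G \<in> \<Delta>"
  shows "(stanley_reisner_ideal \<Delta> :: ('v, 'k::field) mpoly set) = squarefree_ideal E
    \<longleftrightarrow> (\<forall>S. S \<notin> \<Delta> \<longleftrightarrow> (\<exists>e\<in>E. e \<subseteq> S))"
proof -
  have "(stanley_reisner_ideal \<Delta> :: ('v, 'k) mpoly set) = squarefree_ideal (- \<Delta>)"
    by (simp add: stanley_reisner_ideal_def squarefree_ideal_def)
  moreover have "(\<exists>S\<in>- \<Delta>. \<forall>v\<in>S. 0 < a v) \<longleftrightarrow> {v. 0 < a v} \<notin> \<Delta>" for a :: "'v \<Rightarrow> nat"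
  proof
    assume "\<exists>S\<in>- \<Delta>. \<forall>v\<in>S. 0 < a v"
    then obtain S where "S \<notin> \<Delta>" "S \<subseteq> {v. 0 < a v}" by auto
    then show "{v. 0 < a v} \<notin> \<Delta>" using subset_face by metis
  qed (rule bexI[of _ "{v. 0 < a v}"], simp_all)
  moreover have "(\<exists>S\<in>E. \<forall>v\<in>S. 0 < a v) \<longleftrightarrow> (\<exists>S\<in>E. S \<subseteq> {v. 0 < a v})" for a :: "'v \<Rightarrow> nat"
    by auto
  ultimately have "(stanley_reisner_ideal \<Delta> :: ('v, 'k) mpoly set) = squarefree_ideal E
    \<longleftrightarrow> (\<forall>a :: 'v \<Rightarrow> nat. {v. 0 < a v} \<notin> \<Delta> \<longleftrightarrow> (\<exists>S\<in>E. S \<subseteq> {v. 0 < a v}))"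
    by (simp only: squarefree_ideal_eq exponent_ideal_eq_iff)
  also have "\<dots> \<longleftrightarrow> (\<forall>S. S \<notin> \<Delta> \<longleftrightarrow> (\<exists>e\<in>E. e \<subseteq> S))"
  proof (rule iffI, rule allI)
    fix S
    assume *: "\<forall>a :: 'v \<Rightarrow> nat. {v. 0 < a v} \<notin> \<Delta> \<longleftrightarrow> (\<exists>S\<in>E. S \<subseteq> {v. 0 < a v})"
    show "S \<notin> \<Delta> \<longleftrightarrow> (\<exists>e\<in>E. e \<subseteq> S)"
      using *[rule_format, of "\<lambda>v. of_bool (v \<in> S)"] by simp
  qed simp
  finally show ?thesis .
qed

section \<open>Operations on packings\<close>

lemma packs_subset:
  assumes "packs M m a" "M \<subseteq> N"
  shows "packs N m a"
  using assms(1)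
proof (induction m arbitrary: a)
  case (Suc m)
  then show ?case
    unfolding packs.simps using assms(2) by blast
qed simp

text \<open>Peels off \<open>k\<close> copies of one set in a single step, as needed for nonfaces
  with prescribed multiplicities.\<close>

lemma packs_add:
  assumes "S \<in> N" "\<forall>v\<in>S. k \<le> a v" "packs N m (\<lambda>v. a v - (if v \<in> S then k else 0))"
  shows "packs N (k + m) a"
  using assms(2,3)
proof (induction k arbitrary: a)
  case 0
  then show ?case by simp
next
  case (Suc k)
  let ?b = "\<lambda>v. a v - of_bool (v \<in> S)"
  have "(\<lambda>v. ?b v - (if v \<in> S then k else 0)) = (\<lambda>v. a v - (if v \<in> S then Suc k else 0))"
    by auto
  then have "packs N (k + m) ?b"
    using Suc.prems by (intro Suc.IH) auto
  moreover have "\<forall>v\<in>S. 0 < a v"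
    using Suc.prems(1) by auto
  ultimately show ?case
    using assms(1) by auto
qed

text \<open>At each vertex, the successive truncated subtractions leave enough weight exactly when
  the three indicators fit below \<open>a\<close>.\<close>

lemma packs_three_iff:
  "packs N 3 a \<longleftrightarrow> (\<exists>S\<^sub>1\<in>N. \<exists>S\<^sub>2\<in>N. \<exists>S\<^sub>3\<in>N.
    \<forall>v. of_bool (v \<in> S\<^sub>1) + of_bool (v \<in> S\<^sub>2) + of_bool (v \<in> S\<^sub>3) \<le> a v)"
proof -
  have "(\<forall>v\<in>S\<^sub>1. 0 < a v) \<and> (\<forall>v\<in>S\<^sub>2. 0 < a v - of_bool (v \<in> S\<^sub>1))
      \<and> (\<forall>v\<in>S\<^sub>3. 0 < a v - of_bool (v \<in> S\<^sub>1) - of_bool (v \<in> S\<^sub>2))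
    \<longleftrightarrow> (\<forall>v. of_bool (v \<in> S\<^sub>1) + of_bool (v \<in> S\<^sub>2) + of_bool (v \<in> S\<^sub>3) \<le> a v)" (is "?l = ?r")
    for S\<^sub>1 S\<^sub>2 S\<^sub>3
  proof -
    have "?l \<longleftrightarrow> (\<forall>v. (v \<in> S\<^sub>1 \<longrightarrow> 0 < a v) \<and> (v \<in> S\<^sub>2 \<longrightarrow> 0 < a v - of_bool (v \<in> S\<^sub>1))
      \<and> (v \<in> S\<^sub>3 \<longrightarrow> 0 < a v - of_bool (v \<in> S\<^sub>1) - of_bool (v \<in> S\<^sub>2)))"
      by blast
    also have "\<dots> \<longleftrightarrow> ?r"
      by (intro arg_cong[of _ _ All] ext) (auto simp: of_bool_def)
    finally show ?thesis .
  qed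
  note * = this
  show ?thesis
    unfolding *[symmetric] by (simp add: numeral_3_eq_3)
qed

text \<open>Every packed set uses up at least one unit of weight in \<open>A\<close>. With
  \<open>A\<close> the complement of a face, this is the inclusion of the ordinary power in the
  symbolic power.\<close>

lemma packs_le_sum:
  fixes a :: "'v::finite \<Rightarrow> nat"
  assumes "packs N m a" "\<And>S. S \<in> N \<Longrightarrow> S \<inter> A \<noteq> {}"
  shows "m \<le> sum a A"
  using assms(1)
proof (induction m arbitrary: a)
  case (Suc m)
  then obtain S where S: "S \<in> N" "\<forall>v\<in>S. 0 < a v" "packs N m (\<lambda>v. a v - of_bool (v \<in> S))"
    by auto
  obtain v where v: "v \<in> S" "v \<in> A" using assms(2) S(1) by blast
  have "m \<le> (\<Sum>v\<in>A. a v - of_bool (v \<in> S))"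
    by (rule Suc.IH[OF S(3)])
  also have "\<dots> < sum a A"
    using v S(2) by (intro sum_strict_mono_ex1) auto
  finally show ?case by simp
qed simp

section \<open>Weighted bipartite matching\<close>

lemma sum_of_bool_mem: "(\<Sum>v\<in>A. of_bool (v \<in> B)) = card (A \<inter> B)" for A :: "'v::finite set"
  by simp

text \<open>Minimum weight covers are closed under the uncrossing of \<open>C\<^sub>1\<close> and \<open>C\<^sub>2\<close> below, so if decreasing
  both ends of every positive edge at \<open>u\<close> lowered the minimum weight by two, there would be
  a minimum weight cover containing \<open>u\<close> and all its neighbours, and \<open>u\<close> could be dropped.\<close>

lemma weighted_koenig:
  fixes a :: "'v::finite \<Rightarrow> nat"
  assumes "L \<inter> R = {}"
    and "\<And>C. \<forall>u\<in>L. \<forall>v\<in>R. E u v \<longrightarrow> u \<in> C \<or> v \<in> C \<Longrightarrow> m \<le> sum a C"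
  shows "packs {{u, v} | u v. u \<in> L \<and> v \<in> R \<and> E u v} m a"
  using assms(2)
proof (induction m arbitrary: a)
  case (Suc m)
  define cover where "cover C \<longleftrightarrow> (\<forall>u\<in>L. \<forall>v\<in>R. E u v \<longrightarrow> u \<in> C \<or> v \<in> C)" for C
  have weight: "Suc m \<le> sum a C" if "cover C" for C
    using Suc.prems[of C] that unfolding cover_def by blast
  have sum_UNIV: "sum b C = (\<Sum>v\<in>UNIV. if v \<in> C then b v else 0)" for b :: "'v \<Rightarrow> nat" and C
    by (simp add: sum.If_cases)
  \<comment> \<open>This set has weight zero, too little for a cover; hence some edge has positive
    weight at both ends.\<close>
  have "\<not> cover {v. a v = 0}"
    using weight[of "{v. a v = 0}"] by auto
  then obtain u v\<^sub>0 where u: "u \<in> L" "0 < a u" and v\<^sub>0: "v\<^sub>0 \<in> R" "E u v\<^sub>0" "0 < a v\<^sub>0"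
    unfolding cover_def by auto
  define X where "X = {v \<in> R. E u v \<and> 0 < a v}"
  define dec where "dec v w = a w - of_bool (w \<in> {u, v})" for v w
  have "\<exists>v\<in>X. \<forall>C. cover C \<longrightarrow> m \<le> sum (dec v) C"
  proof (rule ccontr)
    assume neg: "\<not> ?thesis"
    \<comment> \<open>Decreasing lowers the weight of \<open>C\<close> by the size of
      \<open>C \<inter> {u, v}\<close>, at most two. A fall from at least \<open>Suc m\<close> to
      below \<open>m\<close> forces both ends into \<open>C\<close> and the original weight to be
      \<open>Suc m\<close>.\<close>
    have tight: "\<exists>C. cover C \<and> sum a C = Suc m \<and> u \<in> C \<and> v \<in> C" if v: "v \<in> X" for v
    proof -
      obtain C where C: "cover C" "sum (dec v) C < m"
        using neg v by auto
      have "sum a C = sum (dec v) C + (\<Sum>w\<in>C. of_bool (w \<in> {u, v}))"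
        unfolding sum.distrib[symmetric]
        using v u(2) by (intro sum.cong) (auto simp: dec_def X_def)
      also have "(\<Sum>w\<in>C. of_bool (w \<in> {u, v})) = card (C \<inter> {u, v})"
        by (rule sum_of_bool_mem)
      finally have eq: "sum a C = sum (dec v) C + card (C \<inter> {u, v})" .
      have "2 \<le> card (C \<inter> {u, v})"
        using eq C(2) weight[OF C(1)] by simp
      moreover have "card {u, v} \<le> 2"
        by (simp add: card_insert_if)
      ultimately have "C \<inter> {u, v} = {u, v}" "card (C \<inter> {u, v}) = 2"
        using card_seteq[of "{u, v}" "C \<inter> {u, v}"] by (auto intro: le_antisym)
      then show ?thesis
        using C eq weight[OF C(1)] by (intro exI[of _ C]) auto
    qed
    have "\<exists>C. cover C \<and> sum a C = Suc m \<and> u \<in> C \<and> Y \<subseteq> C" if "Y \<subseteq> X" for Y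
      using finite[of Y] that
    proof (induction Y rule: finite_induct)
      case empty
      then show ?case using tight[of v\<^sub>0] v\<^sub>0 by (auto simp: X_def)
    next
      case (insert v Y)
      obtain C\<^sub>1 where C\<^sub>1: "cover C\<^sub>1" "sum a C\<^sub>1 = Suc m" "u \<in> C\<^sub>1" "Y \<subseteq> C\<^sub>1"
        using insert by auto
      obtain C\<^sub>2 where C\<^sub>2: "cover C\<^sub>2" "sum a C\<^sub>2 = Suc m" "u \<in> C\<^sub>2" "v \<in> C\<^sub>2"
        using tight[of v] insert.prems by auto
      \<comment> \<open>Both sets are covers, and their weights add up to no more than those of the
        given two. Minimality makes both tight, and \<open>?A\<close> retains \<open>u\<close> and
        all neighbours collected so far.\<close>
      let ?A = "(C\<^sub>1 \<inter> C\<^sub>2 \<inter> L) \<union> ((C\<^sub>1 \<union> C\<^sub>2) \<inter> R)" and ?B = "((C\<^sub>1 \<union> C\<^sub>2) \<inter> L) \<union> (C\<^sub>1 \<inter> C\<^sub>2 \<inter> R)"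
      have A: "cover ?A" and B: "cover ?B"
        using C\<^sub>1(1) C\<^sub>2(1) unfolding cover_def by blast+
      have "sum a ?A + sum a ?B \<le> sum a C\<^sub>1 + sum a C\<^sub>2"
        unfolding sum_UNIV[of a] sum.distrib[symmetric]
        using assms(1) by (intro sum_mono) auto
      then have "sum a ?A = Suc m"
        using weight[OF A] weight[OF B] C\<^sub>1(2) C\<^sub>2(2) by simp
      moreover have "u \<in> ?A" "insert v Y \<subseteq> ?A"
        using C\<^sub>1 C\<^sub>2 u(1) insert.prems by (auto simp: X_def)
      ultimately show ?case using A by blast
    qed
    then obtain C where C: "cover C" "sum a C = Suc m" "u \<in> C" "X \<subseteq> C"
      by blast
    \<comment> \<open>An edge at \<open>u\<close> ends either in \<open>X\<close>, hence in
      \<open>C\<close>, or at weight zero. Trading \<open>u\<close> for the zero set thus keeps a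
      cover but loses the positive weight \<open>a u\<close>.\<close>
    let ?C = "(C - {u}) \<union> {v. a v = 0}"
    have "cover ?C"
      using C(1,4) assms(1) u(1) unfolding cover_def X_def by auto
    moreover have "sum a ?C = sum a (C - {u})"
      by (rule sum.mono_neutral_right) auto
    moreover have "sum a C = a u + sum a (C - {u})"
      using C(3) by (simp add: sum.remove)
    ultimately show False
      using weight[of ?C] C(2) u(2) by simp
  qed
  then obtain v where v: "v \<in> X" "\<And>C. cover C \<Longrightarrow> m \<le> sum (dec v) C"
    by blast
  have "packs {{u, v} | u v. u \<in> L \<and> v \<in> R \<and> E u v} m (dec v)"
    using v(2) by (intro Suc.IH) (simp add: cover_def)
  moreover have "{u, v} \<in> {{u, v} | u v. u \<in> L \<and> v \<in> R \<and> E u v}" "\<forall>w\<in>{u, v}. 0 < a w"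
    using v(1) u by (auto simp: X_def)
  ultimately show ?case
    unfolding packs.simps dec_def by blast
qed simp

section \<open>Pure two-dimensional complexes\<close>

text \<open>Dimension two and purity are combined in \<open>face_extends\<close>, which also bounds
  the size of faces.\<close>

locale pure_two_complex =
  fixes \<Delta> :: "'v::finite set set"
  assumes subset_face: "F \<in> \<Delta> \<Longrightarrow> G \<subseteq> F \<Longrightarrow> G \<in> \<Delta>"
    and vertex_face: "{v} \<in> \<Delta>"
    and face_extends: "F \<in> \<Delta> \<Longrightarrow> \<exists>T\<in>\<Delta>. F \<subseteq> T \<and> card T = 3"
begin

lemma card_face: "F \<in> \<Delta> \<Longrightarrow> card F \<le> 3"
  using face_extends[of F] by (metis card_mono finite)

lemma facets_eq: "facets \<Delta> = {F \<in> \<Delta>. card F = 3}"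
proof -
  have "G = F" if "F \<in> \<Delta>" "G \<in> \<Delta>" "card F = 3" "F \<subseteq> G" for F G
    using card_seteq[OF finite that(4)] card_face[OF that(2)] that(3) by auto
  moreover have "card F = 3" if "F \<in> facets \<Delta>" for F
    using that face_extends[of F] by (auto simp: facets_def)
  ultimately show ?thesis
    by (auto simp: facets_def)
qed

text \<open>Shrinking a face enlarges its complement, so the inequality at a facet implies those at
  its subfaces. Quantifying over all faces avoids checking maximality later.\<close>

lemma facet_weights_iff:
  "(\<forall>F\<in>facets \<Delta>. m \<le> sum a (- F)) \<longleftrightarrow> (\<forall>F\<in>\<Delta>. m \<le> sum a (- F))" for a :: "'v \<Rightarrow> nat"
proof
  assume facets: "\<forall>F\<in>facets \<Delta>. m \<le> sum a (- F)"
  show "\<forall>F\<in>\<Delta>. m \<le> sum a (- F)"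
  proof
    fix F assume "F \<in> \<Delta>"
    then obtain T where T: "T \<in> facets \<Delta>" "F \<subseteq> T"
      using face_extends[of F] by (auto simp: facets_eq)
    have "m \<le> sum a (- T)" using facets T(1) by blast
    also have "\<dots> \<le> sum a (- F)" using T(2) by (intro sum_mono2) auto
    finally show "m \<le> sum a (- F)" .
  qed
qed (simp add: facets_eq)

text \<open>Adjacency in the complement graph \<open>G\<close>; loops are absent since
  \<open>{v, v}\<close> is the face \<open>{v}\<close>.\<close>

definition nonedge :: "'v \<Rightarrow> 'v \<Rightarrow> bool" where
  "nonedge u v \<longleftrightarrow> {u, v} \<notin> \<Delta>"

lemma nonedge_sym: "nonedge u v \<Longrightarrow> nonedge v u"
  by (simp add: nonedge_def insert_commute)

lemma nonedge_irrefl [simp]: "\<not> nonedge v v"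
  by (simp add: nonedge_def vertex_face)

lemma nonedge_not_face: "nonedge u v \<Longrightarrow> u \<in> S \<Longrightarrow> v \<in> S \<Longrightarrow> S \<notin> \<Delta>"
  using subset_face[of S "{u, v}"] by (auto simp: nonedge_def)

text \<open>Koenig's dichotomy in elimination form. In the applications a light cover is studied
  through its complement, which would violate the weight inequality if it were a face.\<close>

lemma packs_or_light_cover:
  assumes "L \<inter> R = {}"
  obtains "packs (- \<Delta>) m a"
  | C where "sum a C < m" "\<And>u v. u \<in> L \<Longrightarrow> v \<in> R \<Longrightarrow> nonedge u v \<Longrightarrow> u \<in> C \<or> v \<in> C"
proof (cases "\<exists>C. sum a C < m \<and> (\<forall>u\<in>L. \<forall>v\<in>R. nonedge u v \<longrightarrow> u \<in> C \<or> v \<in> C)")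
  case True
  then show thesis using that(2) by blast
next
  case False
  then have "packs {{u, v} | u v. u \<in> L \<and> v \<in> R \<and> nonedge u v} m a"
    by (intro weighted_koenig assms) (use not_less in blast)
  then have "packs (- \<Delta>) m a"
    by (rule packs_subset) (auto simp: nonedge_def)
  then show thesis by (rule that(1))
qed

text \<open>Without \<open>v\<^sub>7\<close> the heptagon is a path, bipartite by parity of indices.
  Adding \<open>v\<^sub>7\<close> to a light cover costs nothing and leaves no edge of the heptagon
  uncovered, so the remaining vertices form a face that contradicts \<open>weight\<close>.\<close>

lemma packs_heptagon_zero:
  assumes UNIV: "(UNIV :: 'v set) = {v\<^sub>1, v\<^sub>2, v\<^sub>3, v\<^sub>4, v\<^sub>5, v\<^sub>6, v\<^sub>7}"
    and dist: "distinct [v\<^sub>1, v\<^sub>2, v\<^sub>3, v\<^sub>4, v\<^sub>5, v\<^sub>6, v\<^sub>7]"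
    and nonfaces: "\<And>S. S \<notin> \<Delta> \<longleftrightarrow> (\<exists>e\<in>{{v\<^sub>1, v\<^sub>2}, {v\<^sub>2, v\<^sub>3}, {v\<^sub>3, v\<^sub>4}, {v\<^sub>4, v\<^sub>5}, {v\<^sub>5, v\<^sub>6}, {v\<^sub>6, v\<^sub>7}, {v\<^sub>7, v\<^sub>1}}. e \<subseteq> S)"
    and zero: "a v\<^sub>7 = 0"
    and weight: "\<forall>F\<in>\<Delta>. m \<le> sum a (- F)"
  shows "packs (- \<Delta>) m a"
proof (rule packs_or_light_cover[of "{v\<^sub>1, v\<^sub>3, v\<^sub>5}" "{v\<^sub>2, v\<^sub>4, v\<^sub>6}" m a])
  show "{v\<^sub>1, v\<^sub>3, v\<^sub>5} \<inter> {v\<^sub>2, v\<^sub>4, v\<^sub>6} = {}"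
    using dist by auto
next
  fix C
  assume light: "sum a C < m"
    "\<And>u v. u \<in> {v\<^sub>1, v\<^sub>3, v\<^sub>5} \<Longrightarrow> v \<in> {v\<^sub>2, v\<^sub>4, v\<^sub>6} \<Longrightarrow> nonedge u v \<Longrightarrow> u \<in> C \<or> v \<in> C"
  have edges: "nonedge v\<^sub>1 v\<^sub>2" "nonedge v\<^sub>3 v\<^sub>2" "nonedge v\<^sub>3 v\<^sub>4" "nonedge v\<^sub>5 v\<^sub>4" "nonedge v\<^sub>5 v\<^sub>6"
    unfolding nonedge_def nonfaces by auto
  have "- insert v\<^sub>7 C \<in> \<Delta>"
  proof (rule ccontr)
    assume "- insert v\<^sub>7 C \<notin> \<Delta>"
    then show False
      unfolding nonfaces using light(2) edges by auto
  qed
  then have "m \<le> sum a (insert v\<^sub>7 C)"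
    using weight by force
  also have "\<dots> = sum a C"
    using zero by (cases "v\<^sub>7 \<in> C") (auto simp: insert_absorb)
  finally show ?thesis using light(1) by simp
qed

lemma packs_heptagon:
  assumes UNIV: "(UNIV :: 'v set) = {v\<^sub>1, v\<^sub>2, v\<^sub>3, v\<^sub>4, v\<^sub>5, v\<^sub>6, v\<^sub>7}"
    and dist: "distinct [v\<^sub>1, v\<^sub>2, v\<^sub>3, v\<^sub>4, v\<^sub>5, v\<^sub>6, v\<^sub>7]"
    and nonfaces: "\<And>S. S \<notin> \<Delta> \<longleftrightarrow> (\<exists>e\<in>{{v\<^sub>1, v\<^sub>2}, {v\<^sub>2, v\<^sub>3}, {v\<^sub>3, v\<^sub>4}, {v\<^sub>4, v\<^sub>5}, {v\<^sub>5, v\<^sub>6}, {v\<^sub>6, v\<^sub>7}, {v\<^sub>7, v\<^sub>1}}. e \<subseteq> S)"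
    and weight: "\<forall>F\<in>\<Delta>. 3 \<le> sum a (- F)"
  shows "packs (- \<Delta>) 3 a"
proof (cases "\<forall>v. 0 < a v")
  \<comment> \<open>With no zero weight, three disjoint edges avoiding \<open>v\<^sub>7\<close>
    suffice.\<close>
  case True
  have "{v\<^sub>1, v\<^sub>2} \<in> - \<Delta>" "{v\<^sub>3, v\<^sub>4} \<in> - \<Delta>" "{v\<^sub>5, v\<^sub>6} \<in> - \<Delta>"
    unfolding Compl_iff nonfaces by auto
  moreover have "of_bool (v \<in> {v\<^sub>1, v\<^sub>2}) + of_bool (v \<in> {v\<^sub>3, v\<^sub>4}) + of_bool (v \<in> {v\<^sub>5, v\<^sub>6}) \<le> a v" for v
    using dist True[rule_format, of v] by (auto simp: of_bool_def)
  ultimately show ?thesis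
    unfolding packs_three_iff by blast
next
  case False
  then obtain v where v: "a v = 0" by auto
  have "v \<in> {v\<^sub>1, v\<^sub>2, v\<^sub>3, v\<^sub>4, v\<^sub>5, v\<^sub>6, v\<^sub>7}"
    using UNIV by auto
  then consider "a v\<^sub>1 = 0" | "a v\<^sub>2 = 0" | "a v\<^sub>3 = 0" | "a v\<^sub>4 = 0" | "a v\<^sub>5 = 0" | "a v\<^sub>6 = 0" | "a v\<^sub>7 = 0"
    using v by auto
  then show ?thesis
  proof cases
    \<comment> \<open>The cyclic labelling is rotated so that the vertex of weight zero comes last;
      the set of edges is invariant under rotation.\<close>
    case 1
    then show ?thesis
      by (intro packs_heptagon_zero[of v\<^sub>2 v\<^sub>3 v\<^sub>4 v\<^sub>5 v\<^sub>6 v\<^sub>7 v\<^sub>1])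
        (use UNIV dist weight in \<open>auto simp: nonfaces\<close>)
  next
    case 2
    then show ?thesis
      by (intro packs_heptagon_zero[of v\<^sub>3 v\<^sub>4 v\<^sub>5 v\<^sub>6 v\<^sub>7 v\<^sub>1 v\<^sub>2])
        (use UNIV dist weight in \<open>auto simp: nonfaces\<close>)
  next
    case 3
    then show ?thesis
      by (intro packs_heptagon_zero[of v\<^sub>4 v\<^sub>5 v\<^sub>6 v\<^sub>7 v\<^sub>1 v\<^sub>2 v\<^sub>3])
        (use UNIV dist weight in \<open>auto simp: nonfaces\<close>)
  next
    case 4
    then show ?thesis
      by (intro packs_heptagon_zero[of v\<^sub>5 v\<^sub>6 v\<^sub>7 v\<^sub>1 v\<^sub>2 v\<^sub>3 v\<^sub>4])
        (use UNIV dist weight in \<open>auto simp: nonfaces\<close>)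
  next
    case 5
    then show ?thesis
      by (intro packs_heptagon_zero[of v\<^sub>6 v\<^sub>7 v\<^sub>1 v\<^sub>2 v\<^sub>3 v\<^sub>4 v\<^sub>5])
        (use UNIV dist weight in \<open>auto simp: nonfaces\<close>)
  next
    case 6
    then show ?thesis
      by (intro packs_heptagon_zero[of v\<^sub>7 v\<^sub>1 v\<^sub>2 v\<^sub>3 v\<^sub>4 v\<^sub>5 v\<^sub>6])
        (use UNIV dist weight in \<open>auto simp: nonfaces\<close>)
  next
    case 7
    then show ?thesis
      by (intro packs_heptagon_zero[OF UNIV dist nonfaces _ weight])
  qed
qed

text \<open>The complement \<open>U\<close> of a cover of weight at most two is a nonface of size three; then \<open>a\<close> is packed by
  copies of \<open>U\<close> and of the nonedges joining \<open>U\<close> to the cover.\<close>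

lemma packs_two_triangles:
  assumes UNIV: "(UNIV :: 'v set) = {p\<^sub>1, p\<^sub>2, p\<^sub>3, q\<^sub>1, q\<^sub>2, q\<^sub>3}"
    and dist: "distinct [p\<^sub>1, p\<^sub>2, p\<^sub>3, q\<^sub>1, q\<^sub>2, q\<^sub>3]"
    and p: "{p\<^sub>1, p\<^sub>2} \<in> \<Delta>" "{p\<^sub>1, p\<^sub>3} \<in> \<Delta>" "{p\<^sub>2, p\<^sub>3} \<in> \<Delta>"
    and q: "{q\<^sub>1, q\<^sub>2} \<in> \<Delta>" "{q\<^sub>1, q\<^sub>3} \<in> \<Delta>" "{q\<^sub>2, q\<^sub>3} \<in> \<Delta>"
    and pq: "{p\<^sub>1, q\<^sub>1} \<notin> \<Delta>" "{p\<^sub>2, q\<^sub>2} \<notin> \<Delta>" "{p\<^sub>3, q\<^sub>3} \<notin> \<Delta>"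
    and weight: "\<forall>F\<in>\<Delta>. 3 \<le> sum a (- F)"
  shows "packs (- \<Delta>) 3 a"
proof (rule packs_or_light_cover[of "{p\<^sub>1, p\<^sub>2, p\<^sub>3}" "{q\<^sub>1, q\<^sub>2, q\<^sub>3}" 3 a])
  show "{p\<^sub>1, p\<^sub>2, p\<^sub>3} \<inter> {q\<^sub>1, q\<^sub>2, q\<^sub>3} = {}"
    using dist by auto
next
  fix C
  assume light: "sum a C < 3"
    "\<And>u v. u \<in> {p\<^sub>1, p\<^sub>2, p\<^sub>3} \<Longrightarrow> v \<in> {q\<^sub>1, q\<^sub>2, q\<^sub>3} \<Longrightarrow> nonedge u v \<Longrightarrow> u \<in> C \<or> v \<in> C"
  have U_nonface: "- C \<notin> \<Delta>"
    using light(1) weight by force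
  \<comment> \<open>Pairs inside one of the triangles are edges by assumption, and a nonedge between
    the triangles would have an end in \<open>C\<close>.\<close>
  have clique: "{u, v} \<in> \<Delta>" if uv: "u \<notin> C" "v \<notin> C" for u v
  proof -
    have "nonedge u' v' \<Longrightarrow> u' \<in> C \<or> v' \<in> C" if "u' \<in> {p\<^sub>1, p\<^sub>2, p\<^sub>3}" "v' \<in> {q\<^sub>1, q\<^sub>2, q\<^sub>3}" for u' v'
      using light(2) that by blast
    then have pq': "{u', v'} \<in> \<Delta>" "{v', u'} \<in> \<Delta>" if "u' \<in> {p\<^sub>1, p\<^sub>2, p\<^sub>3}" "v' \<in> {q\<^sub>1, q\<^sub>2, q\<^sub>3}" "u' \<notin> C" "v' \<notin> C" for u' v'
      using that by (auto simp: nonedge_def insert_commute)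
    have "u \<in> {p\<^sub>1, p\<^sub>2, p\<^sub>3} \<or> u \<in> {q\<^sub>1, q\<^sub>2, q\<^sub>3}" "v \<in> {p\<^sub>1, p\<^sub>2, p\<^sub>3} \<or> v \<in> {q\<^sub>1, q\<^sub>2, q\<^sub>3}"
      using UNIV by auto
    moreover have "{u, v} \<in> \<Delta>" if "u \<in> {p\<^sub>1, p\<^sub>2, p\<^sub>3}" "v \<in> {p\<^sub>1, p\<^sub>2, p\<^sub>3}"
      using that p vertex_face by (auto simp: insert_commute)
    moreover have "{u, v} \<in> \<Delta>" if "u \<in> {q\<^sub>1, q\<^sub>2, q\<^sub>3}" "v \<in> {q\<^sub>1, q\<^sub>2, q\<^sub>3}"
      using that q vertex_face by (auto simp: insert_commute)
    ultimately show ?thesis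
      using pq' uv by blast
  qed
  \<comment> \<open>The two triangles are forgotten here and only the matching between
    \<open>- C\<close> and the cover is kept, so each matched pair can be oriented
    independently.\<close>
  have pack: "packs (- \<Delta>) 3 a"
    if UNIV: "(UNIV :: 'v set) = {u\<^sub>1, u\<^sub>2, u\<^sub>3, c\<^sub>1, c\<^sub>2, c\<^sub>3}" and dist: "distinct [u\<^sub>1, u\<^sub>2, u\<^sub>3, c\<^sub>1, c\<^sub>2, c\<^sub>3]"
      and uc: "{u\<^sub>1, c\<^sub>1} \<notin> \<Delta>" "{u\<^sub>2, c\<^sub>2} \<notin> \<Delta>" "{u\<^sub>3, c\<^sub>3} \<notin> \<Delta>"
      and c: "c\<^sub>1 \<in> C" "c\<^sub>2 \<in> C" "c\<^sub>3 \<in> C"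
    for u\<^sub>1 u\<^sub>2 u\<^sub>3 c\<^sub>1 c\<^sub>2 c\<^sub>3
  proof -
    have subset: "- C \<subseteq> {u\<^sub>1, u\<^sub>2, u\<^sub>3}" using UNIV c by auto
    have no_pair: "\<not> - C \<subseteq> {u, v}" if "{u, v} \<in> \<Delta>" for u v
      using subset_face[OF that] U_nonface by blast
    have u: "u\<^sub>1 \<notin> C" "u\<^sub>2 \<notin> C" "u\<^sub>3 \<notin> C"
    proof -
      have sub1: "\<not> - C \<subseteq> {w}" for w using no_pair[of w w] vertex_face by simp
      have sub2: "\<not> - C \<subseteq> {u, v}" for u v
      proof
        assume s: "- C \<subseteq> {u, v}"
        show False
        proof (cases "u \<in> C \<or> v \<in> C")
          case True
          then have "- C \<subseteq> {v} \<or> - C \<subseteq> {u}" using s by blast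
          then show False using sub1 by blast
        next
          case False
          then show False using clique no_pair s by blast
        qed
      qed
      show "u\<^sub>1 \<notin> C" "u\<^sub>2 \<notin> C" "u\<^sub>3 \<notin> C"
        using subset sub2[of u\<^sub>2 u\<^sub>3] sub2[of u\<^sub>1 u\<^sub>3] sub2[of u\<^sub>1 u\<^sub>2] by blast+
    qed
    then have C: "- C = {u\<^sub>1, u\<^sub>2, u\<^sub>3}" "C = {c\<^sub>1, c\<^sub>2, c\<^sub>3}"
      using UNIV c dist by auto
    \<comment> \<open>The facet through \<open>{x, y}\<close> misses \<open>z\<close>, as
      \<open>- C\<close> is a nonface, and misses \<open>c\<close> and \<open>d\<close>, which form
      nonedges with \<open>x\<close> and \<open>y\<close>. So it is \<open>{x, y, e}\<close>, and
      its complement gives the bound.\<close>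
    have third: "3 \<le> a c + a d + a z"
      if xyz: "{x, y, z} = {u\<^sub>1, u\<^sub>2, u\<^sub>3}" "{c, d, e} = {c\<^sub>1, c\<^sub>2, c\<^sub>3}" "distinct [x, y, z, c, d, e]"
        and xc: "{x, c} \<notin> \<Delta>" "{y, d} \<notin> \<Delta>" for x y z c d e
    proof -
      have Cc: "- C = {x, y, z}" using C(1) xyz(1) by simp
      have UNIV': "(UNIV :: 'v set) = {x, y, z} \<union> {c, d, e}"
        unfolding UNIV xyz(1,2) by auto
      have "x \<notin> C" "y \<notin> C" using Cc by blast+
      then have "{x, y} \<in> \<Delta>" by (rule clique)
      then obtain T where T: "T \<in> \<Delta>" "{x, y} \<subseteq> T" "card T = 3"
        using face_extends by blast
      have "z \<notin> T"
      proof
        assume "z \<in> T"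
        then have "- C \<subseteq> T" unfolding Cc using T(2) by blast
        then show False using subset_face[OF T(1)] U_nonface by blast
      qed
      moreover have "c \<notin> T" "d \<notin> T"
        using subset_face[OF T(1), of "{x, c}"] subset_face[OF T(1), of "{y, d}"] T(2) xc by auto
      ultimately have "T \<subseteq> {x, y, e}"
        using UNIV' by blast
      moreover have "card {x, y, e} = 3"
        using xyz(3) by simp
      ultimately have "T = {x, y, e}"
        using card_seteq[of "{x, y, e}" T] T(3) by simp
      with T have "- T = {c, d, z}"
        using UNIV' xyz(3) by auto
      moreover have "sum a {c, d, z} = a c + a d + a z"
        using xyz(3) by auto
      ultimately show ?thesis
        using weight[rule_format, OF T(1)] by simp
    qed
    have t: "3 \<le> a c\<^sub>1 + a c\<^sub>2 + a u\<^sub>3" "3 \<le> a c\<^sub>1 + a c\<^sub>3 + a u\<^sub>2" "3 \<le> a c\<^sub>2 + a c\<^sub>3 + a u\<^sub>1"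
      using dist uc by (intro third[of u\<^sub>1 u\<^sub>2 _ _ _ c\<^sub>3] third[of u\<^sub>1 u\<^sub>3 _ _ _ c\<^sub>2] third[of u\<^sub>2 u\<^sub>3 _ _ _ c\<^sub>1]; auto)+
    have s: "a c\<^sub>1 + a c\<^sub>2 + a c\<^sub>3 \<le> 2"
      using light(1) C(2) dist by simp
    \<comment> \<open>The nonedge at each cover vertex is used as often as the weight of that
      vertex, and \<open>k\<close> copies of \<open>- C\<close> make up the remainder to three. The
      bounds \<open>t\<close> leave room for both.\<close>
    define k where "k = 3 - (a c\<^sub>1 + a c\<^sub>2 + a c\<^sub>3)"
    have le: "a c\<^sub>1 + k \<le> a u\<^sub>1" "a c\<^sub>2 + k \<le> a u\<^sub>2" "a c\<^sub>3 + k \<le> a u\<^sub>3"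
      using t s by (auto simp: k_def)
    define b\<^sub>1 where "b\<^sub>1 v = a v - (if v \<in> {u\<^sub>1, c\<^sub>1} then a c\<^sub>1 else 0)" for v
    define b\<^sub>2 where "b\<^sub>2 v = b\<^sub>1 v - (if v \<in> {u\<^sub>2, c\<^sub>2} then a c\<^sub>2 else 0)" for v
    define b\<^sub>3 where "b\<^sub>3 v = b\<^sub>2 v - (if v \<in> {u\<^sub>3, c\<^sub>3} then a c\<^sub>3 else 0)" for v
    note b = b\<^sub>1_def b\<^sub>2_def b\<^sub>3_def
    have "packs (- \<Delta>) (k + 0) b\<^sub>3"
      by (rule packs_add[of "- C"]) (use U_nonface C(1) le dist in \<open>auto simp: b\<close>)
    then have "packs (- \<Delta>) (a c\<^sub>3 + (k + 0)) b\<^sub>2"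
      unfolding b\<^sub>3_def by (rule packs_add[rotated 2]) (use uc(3) le dist in \<open>auto simp: b\<close>)
    then have "packs (- \<Delta>) (a c\<^sub>2 + (a c\<^sub>3 + (k + 0))) b\<^sub>1"
      unfolding b\<^sub>2_def by (rule packs_add[rotated 2]) (use uc(2) le dist in \<open>auto simp: b\<close>)
    then have "packs (- \<Delta>) (a c\<^sub>1 + (a c\<^sub>2 + (a c\<^sub>3 + (k + 0)))) a"
      unfolding b\<^sub>1_def by (rule packs_add[rotated 2]) (use uc(1) le dist in \<open>auto simp: b\<close>)
    moreover have "a c\<^sub>1 + (a c\<^sub>2 + (a c\<^sub>3 + (k + 0))) = 3"
      using s by (simp add: k_def)
    ultimately show ?thesis by simp
  qed
  have C: "p\<^sub>1 \<in> C \<or> q\<^sub>1 \<in> C" "p\<^sub>2 \<in> C \<or> q\<^sub>2 \<in> C" "p\<^sub>3 \<in> C \<or> q\<^sub>3 \<in> C"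
    using clique pq by blast+
  \<comment> \<open>In each matched pair a member of \<open>C\<close> is named \<open>c\<close> and
    its partner \<open>u\<close>.\<close>
  have "\<exists>u c. {u, c} = {p, q} \<and> u \<noteq> c \<and> c \<in> C" if "p \<in> C \<or> q \<in> C" "p \<noteq> q" for p q
    using that by (metis insert_commute)
  then obtain u\<^sub>1 c\<^sub>1 u\<^sub>2 c\<^sub>2 u\<^sub>3 c\<^sub>3 where uc: "{u\<^sub>1, c\<^sub>1} = {p\<^sub>1, q\<^sub>1}" "c\<^sub>1 \<in> C"
    "{u\<^sub>2, c\<^sub>2} = {p\<^sub>2, q\<^sub>2}" "c\<^sub>2 \<in> C" "{u\<^sub>3, c\<^sub>3} = {p\<^sub>3, q\<^sub>3}" "c\<^sub>3 \<in> C"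
    "u\<^sub>1 \<noteq> c\<^sub>1" "u\<^sub>2 \<noteq> c\<^sub>2" "u\<^sub>3 \<noteq> c\<^sub>3"
    using C dist by (metis distinct_length_2_or_more)
  show ?thesis
  proof (rule pack)
    have "(UNIV :: 'v set) = {p\<^sub>1, q\<^sub>1} \<union> {p\<^sub>2, q\<^sub>2} \<union> {p\<^sub>3, q\<^sub>3}"
      using UNIV by auto
    then show "(UNIV :: 'v set) = {u\<^sub>1, u\<^sub>2, u\<^sub>3, c\<^sub>1, c\<^sub>2, c\<^sub>3}"
      unfolding uc(1,3,5)[symmetric] by auto
    have "{u\<^sub>1, c\<^sub>1} \<inter> {u\<^sub>2, c\<^sub>2} = {}" "{u\<^sub>1, c\<^sub>1} \<inter> {u\<^sub>3, c\<^sub>3} = {}" "{u\<^sub>2, c\<^sub>2} \<inter> {u\<^sub>3, c\<^sub>3} = {}"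
      unfolding uc(1,3,5) using dist by auto
    then show "distinct [u\<^sub>1, u\<^sub>2, u\<^sub>3, c\<^sub>1, c\<^sub>2, c\<^sub>3]"
      using uc(7-9) by auto
  qed (use uc pq in simp_all)
qed

end

section \<open>Complexes with equal third powers\<close>

text \<open>The assumption \<open>packs_if_heavy\<close> expresses the nontrivial inclusion, of the
  symbolic cube in the ordinary cube.\<close>

locale cubic_two_complex = pure_two_complex +
  assumes packs_if_heavy: "\<forall>F\<in>\<Delta>. 3 \<le> sum a (- F) \<Longrightarrow> packs (- \<Delta>) 3 a"
    and card_vertices: "6 \<le> CARD('a)"
begin

lemma two_le_card_nonface:
  assumes "S \<notin> \<Delta>"
  shows "2 \<le> card S"
proof (rule ccontr)
  assume "\<not> 2 \<le> card S"
  then have "card S = 0 \<or> card S = 1" by linarith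
  then obtain v where "S \<subseteq> {v}"
    by (auto simp: card_1_singleton_iff)
  then show False using assms subset_face[OF vertex_face] by blast
qed

text \<open>The first premise is the weight inequality without complements. Nonfaces have at least
  two vertices, so three of them consume weight at least six; a total of at most six forces three
  pairs and leaves no slack.\<close>

lemma light_weight_decomposition:
  fixes a :: "'a \<Rightarrow> nat"
  assumes "\<And>F. F \<in> \<Delta> \<Longrightarrow> sum a F + 3 \<le> sum a UNIV" and "sum a UNIV \<le> 6"
  obtains S\<^sub>1 S\<^sub>2 S\<^sub>3 where "S\<^sub>1 \<notin> \<Delta>" "S\<^sub>2 \<notin> \<Delta>" "S\<^sub>3 \<notin> \<Delta>"
    "card S\<^sub>1 = 2" "card S\<^sub>2 = 2" "card S\<^sub>3 = 2"
    "\<And>v. a v = of_bool (v \<in> S\<^sub>1) + of_bool (v \<in> S\<^sub>2) + of_bool (v \<in> S\<^sub>3)"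
    "sum a UNIV = 6"
proof -
  have "3 \<le> sum a (- F)" if "F \<in> \<Delta>" for F
  proof -
    have "sum a UNIV = sum a F + sum a (- F)"
      using sum.subset_diff[of F UNIV a] by (simp add: Compl_eq_Diff_UNIV)
    then show ?thesis using assms(1)[OF that] by simp
  qed
  then obtain S\<^sub>1 S\<^sub>2 S\<^sub>3 where S: "S\<^sub>1 \<notin> \<Delta>" "S\<^sub>2 \<notin> \<Delta>" "S\<^sub>3 \<notin> \<Delta>"
    and le: "\<And>v. of_bool (v \<in> S\<^sub>1) + of_bool (v \<in> S\<^sub>2) + of_bool (v \<in> S\<^sub>3) \<le> a v"
    using packs_if_heavy[of a] unfolding packs_three_iff Compl_iff by auto
  let ?b = "\<lambda>v. of_bool (v \<in> S\<^sub>1) + of_bool (v \<in> S\<^sub>2) + of_bool (v \<in> S\<^sub>3) :: nat"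
  have sum_b: "sum ?b UNIV = card S\<^sub>1 + card S\<^sub>2 + card S\<^sub>3"
    by (simp add: sum.distrib)
  have "sum ?b UNIV \<le> sum a UNIV"
    by (intro sum_mono le)
  note c = two_le_card_nonface[OF S(1)] two_le_card_nonface[OF S(2)] two_le_card_nonface[OF S(3)]
  have eq: "a v = ?b v" for v
  proof (rule ccontr)
    assume "a v \<noteq> ?b v"
    then have "?b v < a v" using le[of v] by linarith
    then have "sum ?b UNIV < sum a UNIV"
    proof (intro sum_strict_mono_ex1)
      show "\<forall>v\<in>UNIV. ?b v \<le> a v" using le by blast
      show "\<exists>v\<in>UNIV. ?b v < a v" using \<open>?b v < a v\<close> by blast
    qed simp
    then show False using sum_b c assms(2) by linarith
  qed
  show thesis
    by (rule that[OF S _ _ _ eq]) (use sum_b c \<open>sum ?b UNIV \<le> sum a UNIV\<close> assms(2) in linarith)+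
qed

text \<open>Serves to derive contradictions from weights of total five.\<close>

lemma light_weight_sum:
  fixes a :: "'a \<Rightarrow> nat"
  assumes "\<And>F. F \<in> \<Delta> \<Longrightarrow> sum a F + 3 \<le> sum a UNIV" and "sum a UNIV \<le> 6"
  shows "sum a UNIV = 6"
  by (rule light_weight_decomposition[OF assms])

text \<open>The indicator of \<open>W\<close> satisfies the weight inequality, since a face has at
  most three of the six vertices. Its values are at most one, which makes the three pairs
  disjoint.\<close>

lemma six_set_matching:
  assumes "card W = 6"
  obtains S\<^sub>1 S\<^sub>2 S\<^sub>3 where "S\<^sub>1 \<notin> \<Delta>" "S\<^sub>2 \<notin> \<Delta>" "S\<^sub>3 \<notin> \<Delta>"
    "card S\<^sub>1 = 2" "card S\<^sub>2 = 2" "card S\<^sub>3 = 2"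
    "S\<^sub>1 \<inter> S\<^sub>2 = {}" "S\<^sub>1 \<inter> S\<^sub>3 = {}" "S\<^sub>2 \<inter> S\<^sub>3 = {}" "W = S\<^sub>1 \<union> S\<^sub>2 \<union> S\<^sub>3"
proof -
  let ?a = "\<lambda>v. of_bool (v \<in> W) :: nat"
  have "card (F \<inter> W) \<le> 3" if "F \<in> \<Delta>" for F
    using card_face[OF subset_face[OF that, of "F \<inter> W"]] by simp
  then have "sum ?a F + 3 \<le> sum ?a UNIV" if "F \<in> \<Delta>" for F
    using assms that by (simp add: sum_of_bool_mem)
  moreover have "sum ?a UNIV \<le> 6"
    using assms by simp
  ultimately show thesis
  proof (rule light_weight_decomposition)
    fix S\<^sub>1 S\<^sub>2 S\<^sub>3
    assume S: "S\<^sub>1 \<notin> \<Delta>" "S\<^sub>2 \<notin> \<Delta>" "S\<^sub>3 \<notin> \<Delta>"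
      "card S\<^sub>1 = 2" "card S\<^sub>2 = 2" "card S\<^sub>3 = 2"
      and a: "\<And>v. ?a v = of_bool (v \<in> S\<^sub>1) + of_bool (v \<in> S\<^sub>2) + of_bool (v \<in> S\<^sub>3)"
    have mem: "(v \<in> W \<longleftrightarrow> v \<in> S\<^sub>1 \<or> v \<in> S\<^sub>2 \<or> v \<in> S\<^sub>3) \<and> \<not> (v \<in> S\<^sub>1 \<and> v \<in> S\<^sub>2)
        \<and> \<not> (v \<in> S\<^sub>1 \<and> v \<in> S\<^sub>3) \<and> \<not> (v \<in> S\<^sub>2 \<and> v \<in> S\<^sub>3)" for v
      using a[of v] by (auto simp: of_bool_def split: if_splits)
    show thesis
      by (rule that[OF S]) (use mem in blast)+
  qed
qed

lemma six_set_neighbour: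
  assumes "card W = 6" "v \<in> W"
  obtains w where "w \<in> W" "nonedge v w"
proof -
  obtain S\<^sub>1 S\<^sub>2 S\<^sub>3 where S: "S\<^sub>1 \<notin> \<Delta>" "S\<^sub>2 \<notin> \<Delta>" "S\<^sub>3 \<notin> \<Delta>"
    "card S\<^sub>1 = 2" "card S\<^sub>2 = 2" "card S\<^sub>3 = 2" "W = S\<^sub>1 \<union> S\<^sub>2 \<union> S\<^sub>3"
    using six_set_matching[OF assms(1)] by metis
  then obtain S where S: "S \<notin> \<Delta>" "card S = 2" "S \<subseteq> W" "v \<in> S"
    using assms(2) by blast
  then obtain w where "S = {v, w}"
    by (auto simp: card_2_iff)
  then show thesis
    using that S by (auto simp: nonedge_def)
qed

text \<open>The name refers to the graph of \<open>\<Delta>\<close>; in \<open>G\<close> these are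
  the independent sets. Such a set need not be a face.\<close>

definition clique :: "'a set \<Rightarrow> bool" where
  "clique K \<longleftrightarrow> (\<forall>u\<in>K. \<forall>v\<in>K. \<not> nonedge u v)"

text \<open>Four such vertices would lie in a six-set, whose three matching pairs contain at most
  one of them each.\<close>

lemma card_clique:
  assumes "clique K"
  shows "card K \<le> 3"
proof (rule ccontr)
  assume "\<not> card K \<le> 3"
  then obtain I where I: "I \<subseteq> K" "card I = 4"
    using obtain_subset_with_card_n[of 4 K] by auto
  obtain W where W: "I \<subseteq> W" "card W = 6"
    using exists_subset_between[of I 6 UNIV] card_vertices I by auto
  obtain S\<^sub>1 S\<^sub>2 S\<^sub>3 where S: "S\<^sub>1 \<notin> \<Delta>" "S\<^sub>2 \<notin> \<Delta>" "S\<^sub>3 \<notin> \<Delta>"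
    "card S\<^sub>1 = 2" "card S\<^sub>2 = 2" "card S\<^sub>3 = 2" "W = S\<^sub>1 \<union> S\<^sub>2 \<union> S\<^sub>3"
    using six_set_matching[OF W(2)] by metis
  have le: "card (I \<inter> S) \<le> 1" if "S \<notin> \<Delta>" "card S = 2" for S
  proof -
    obtain u v where uv: "S = {u, v}" using \<open>card S = 2\<close> by (auto simp: card_2_iff)
    then have "nonedge u v" using that by (simp add: nonedge_def)
    then have "u \<notin> I \<or> v \<notin> I"
      using assms I(1) by (auto simp: clique_def)
    then have "I \<inter> S \<subseteq> {u} \<or> I \<inter> S \<subseteq> {v}"
      using uv by auto
    then show ?thesis
      using card_mono[of "{u}" "I \<inter> S"] card_mono[of "{v}" "I \<inter> S"] by auto
  qed
  have "I = I \<inter> S\<^sub>1 \<union> I \<inter> S\<^sub>2 \<union> I \<inter> S\<^sub>3"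
    using W(1) S(7) by blast
  then have "card I \<le> card (I \<inter> S\<^sub>1) + card (I \<inter> S\<^sub>2) + card (I \<inter> S\<^sub>3)"
    using card_Un_le[of "I \<inter> S\<^sub>1 \<union> I \<inter> S\<^sub>2" "I \<inter> S\<^sub>3"] card_Un_le[of "I \<inter> S\<^sub>1" "I \<inter> S\<^sub>2"] by simp
  then show False
    using I(2) le[OF S(1,4)] le[OF S(2,5)] le[OF S(3,6)] by simp
qed

lemma no_triangle:
  assumes "nonedge u v" "nonedge v w"
  shows "\<not> nonedge u w"
proof
  assume uw: "nonedge u w"
  have dist: "u \<noteq> v" "v \<noteq> w" "u \<noteq> w" using assms uw by auto
  \<comment> \<open>A face contains at most one of the three vertices, hence weight at most two out
    of five; but admissible weights of total at most six have total exactly six.\<close>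
  define a where "a x = 2 * of_bool (x = u) + 2 * of_bool (x = v) + (of_bool (x = w) :: nat)" for x
  have sum_a: "sum a X = 2 * of_bool (u \<in> X) + 2 * of_bool (v \<in> X) + of_bool (w \<in> X)" for X
    by (simp add: a_def[abs_def] sum.distrib sum_distrib_left[symmetric])
  have "sum a F + 3 \<le> sum a UNIV" if "F \<in> \<Delta>" for F
  proof -
    have "\<not> (u \<in> F \<and> v \<in> F)" "\<not> (v \<in> F \<and> w \<in> F)" "\<not> (u \<in> F \<and> w \<in> F)"
      using that assms uw nonedge_not_face by blast+
    then show ?thesis
      by (auto simp: sum_a)
  qed
  moreover have "sum a UNIV = 5" by (simp add: sum_a)
  ultimately show False
    using light_weight_sum[of a] by simp
qed

text \<open>Otherwise every face meets \<open>W\<close> in at most two vertices, and the indicator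
  of \<open>W\<close> is an admissible weight of total five.\<close>

lemma five_set_face:
  assumes "card W = 5"
  shows "\<exists>F\<in>\<Delta>. F \<subseteq> W \<and> card F = 3"
proof (rule ccontr)
  assume neg: "\<not> ?thesis"
  let ?a = "\<lambda>v. of_bool (v \<in> W) :: nat"
  have "card (F \<inter> W) \<le> 2" if "F \<in> \<Delta>" for F
  proof -
    have "F \<inter> W \<in> \<Delta>" using subset_face[OF that] by simp
    moreover from this have "card (F \<inter> W) \<noteq> 3" using neg by blast
    ultimately show ?thesis using card_face[of "F \<inter> W"] by linarith
  qed
  then have "sum ?a F + 3 \<le> sum ?a UNIV" if "F \<in> \<Delta>" for F
    using assms that by simp
  moreover have "sum ?a UNIV = 5" using assms by simp
  ultimately show False
    using light_weight_sum[of ?a] by simp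
qed

text \<open>Independent sets of a five-cycle have at most two vertices, while
  \<open>five_set_face\<close> supplies a face with three.\<close>

lemma no_pentagon:
  assumes "distinct [v\<^sub>1, v\<^sub>2, v\<^sub>3, v\<^sub>4, v\<^sub>5]"
    and "nonedge v\<^sub>1 v\<^sub>2" "nonedge v\<^sub>2 v\<^sub>3" "nonedge v\<^sub>3 v\<^sub>4" "nonedge v\<^sub>4 v\<^sub>5" "nonedge v\<^sub>5 v\<^sub>1"
  shows False
proof -
  have "card {v\<^sub>1, v\<^sub>2, v\<^sub>3, v\<^sub>4, v\<^sub>5} = 5" using assms(1) by simp
  then obtain F where F: "F \<in> \<Delta>" "F \<subseteq> {v\<^sub>1, v\<^sub>2, v\<^sub>3, v\<^sub>4, v\<^sub>5}" "card F = 3"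
    using five_set_face by blast
  have no: "\<not> (v\<^sub>1 \<in> F \<and> v\<^sub>2 \<in> F)" "\<not> (v\<^sub>2 \<in> F \<and> v\<^sub>3 \<in> F)" "\<not> (v\<^sub>3 \<in> F \<and> v\<^sub>4 \<in> F)"
    "\<not> (v\<^sub>4 \<in> F \<and> v\<^sub>5 \<in> F)" "\<not> (v\<^sub>5 \<in> F \<and> v\<^sub>1 \<in> F)"
    using assms(2-) nonedge_not_face F(1) by blast+
  \<comment> \<open>If \<open>v\<^sub>1\<close> lies in \<open>F\<close>, at most one of
    \<open>v\<^sub>3\<close> and \<open>v\<^sub>4\<close> joins it; otherwise \<open>F\<close> has
    at most one of \<open>v\<^sub>2\<close>, \<open>v\<^sub>3\<close> and one of
    \<open>v\<^sub>4\<close>, \<open>v\<^sub>5\<close>.\<close>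
  obtain x y where "F \<subseteq> {x, y}"
  proof (cases "v\<^sub>1 \<in> F")
    case True
    show thesis
      by (cases "v\<^sub>3 \<in> F"; rule that[of v\<^sub>1 "if v\<^sub>3 \<in> F then v\<^sub>3 else v\<^sub>4"]) (use True F(2) no in auto)
  next
    case False
    show thesis
      by (cases "v\<^sub>2 \<in> F"; cases "v\<^sub>4 \<in> F";
          rule that[of "if v\<^sub>2 \<in> F then v\<^sub>2 else v\<^sub>3" "if v\<^sub>4 \<in> F then v\<^sub>4 else v\<^sub>5"])
        (use False F(2) no in auto)
  qed
  then have "card F \<le> card {x, y}" by (intro card_mono) auto
  also have "\<dots> \<le> 2" by (simp add: card_insert_if)
  finally show False using F(3) by simp
qed

section \<open>Degrees in the complement graph\<close>

definition nbrs :: "'a \<Rightarrow> 'a set" where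
  "nbrs v = {u. nonedge v u}"

lemma clique_nbrs: "clique (nbrs v)"
  unfolding clique_def nbrs_def using no_triangle by blast

text \<open>Five vertices outside the neighbourhood would form with \<open>v\<close> a six-set in
  which \<open>v\<close> cannot be matched.\<close>

lemma card_vertices_le: "CARD('a) \<le> 5 + card (nbrs v)"
proof -
  let ?N = "- insert v (nbrs v)"
  have "card ?N \<le> 4"
  proof (rule ccontr)
    assume "\<not> card ?N \<le> 4"
    then obtain T where T: "T \<subseteq> ?N" "card T = 5"
      using obtain_subset_with_card_n[of 5 ?N] by auto
    then have "card (insert v T) = 6" "v \<in> insert v T" by (auto simp: card_insert_if)
    then obtain w where "w \<in> insert v T" "nonedge v w" by (rule six_set_neighbour)
    then show False using T(1) by (auto simp: nbrs_def)
  qed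
  moreover have "CARD('a) = card (insert v (nbrs v)) + card ?N"
    using card_Un_disjoint[of "insert v (nbrs v)" ?N] by simp
  moreover have "card (insert v (nbrs v)) \<le> Suc (card (nbrs v))"
    by (simp add: card_insert_if)
  ultimately show ?thesis by linarith
qed

text \<open>Neighbourhoods are cliques, so the degree is at most three. If it is three, then
  \<open>v\<close> and three vertices outside its neighbourhood are too many for a clique, which
  yields a nonedge \<open>b\<close>, \<open>c\<close> among the latter. Both ends share a neighbour
  with \<open>v\<close>, closing a pentagon.\<close>

lemma card_nbrs_le:
  assumes "7 \<le> CARD('a)"
  shows "card (nbrs v) \<le> 2"
proof (rule ccontr)
  assume "\<not> card (nbrs v) \<le> 2"
  then have "card (nbrs v) = 3"
    using card_clique[OF clique_nbrs] by (simp add: le_antisym)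
  let ?R = "- insert v (nbrs v)"
  have v: "v \<notin> nbrs v" by (simp add: nbrs_def)
  have "card ?R = CARD('a) - 4"
    using \<open>card (nbrs v) = 3\<close> v by (simp add: Compl_eq_Diff_UNIV card_Diff_subset)
  then have "3 \<le> card ?R" using assms by linarith
  then obtain R where R: "R \<subseteq> ?R" "card R = 3"
    by (rule obtain_subset_with_card_n) blast
  then have "card (insert v R) = 4" by (auto simp: card_insert_if)
  then have "\<not> clique (insert v R)"
    using card_clique by fastforce
  then obtain b c where bc: "b \<in> R" "c \<in> R" "nonedge b c"
    using R(1) unfolding clique_def nbrs_def by (auto dest: nonedge_sym)
  have common: "\<exists>x. nonedge v x \<and> nonedge r x" if "r \<in> R" for r
  proof (rule ccontr)
    assume "\<not> ?thesis"
    then have "clique (insert r (nbrs v))"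
      using clique_nbrs[of v] unfolding clique_def nbrs_def by (auto dest: nonedge_sym)
    then have "card (insert r (nbrs v)) \<le> 3" by (rule card_clique)
    then show False
      using that R(1) \<open>card (nbrs v) = 3\<close> by (auto simp: card_insert_if)
  qed
  obtain x y where x: "nonedge v x" "nonedge b x" and y: "nonedge v y" "nonedge c y"
    using common bc by blast
  have "x \<noteq> y"
    using no_triangle[OF bc(3) y(2)] x(2) by blast
  moreover have "b \<noteq> v" "c \<noteq> v" "\<not> nonedge v b" "\<not> nonedge v c"
    using bc(1,2) R(1) by (auto simp: nbrs_def)
  moreover have "b \<noteq> c" "v \<noteq> x" "v \<noteq> y" "b \<noteq> x" "c \<noteq> y" using bc(3) x y by auto
  moreover have "b \<noteq> y" "c \<noteq> x" using x y \<open>\<not> nonedge v b\<close> \<open>\<not> nonedge v c\<close> by auto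
  ultimately have "distinct [v, x, b, c, y]" by auto
  then show False
    by (rule no_pentagon) (use x y bc in \<open>auto dest: nonedge_sym\<close>)
qed

text \<open>The bounds leave no slack: with \<open>n\<close> vertices and degree \<open>d\<close>, 7
  \<le> \<open>n\<close> \<le> 5 + \<open>d\<close> \<le> 7.\<close>

lemma seven_vertices:
  assumes "7 \<le> CARD('a)"
  shows "CARD('a) = 7" "card (nbrs v) = 2"
  using assms card_nbrs_le[OF assms, of v] card_vertices_le[of v] by linarith+

text \<open>A counterexample is a clique \<open>{v, w\<^sub>3, w\<^sub>4}\<close>. Weight two at
  \<open>v\<close> and one at \<open>w\<^sub>3\<close>, \<open>w\<^sub>4\<close> and the two
  neighbours of \<open>v\<close> splits into three nonedges. Two of them contain \<open>v\<close>,
  hence neither \<open>w\<^sub>3\<close> nor \<open>w\<^sub>4\<close>, and the third cannot contain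
  both.\<close>

lemma nonface_contains_nonedge:
  assumes "7 \<le> CARD('a)" "S \<notin> \<Delta>"
  shows "\<exists>u\<in>S. \<exists>v\<in>S. nonedge u v"
proof (rule ccontr)
  assume "\<not> ?thesis"
  then have clique: "clique S" by (auto simp: clique_def)
  have "card S \<noteq> 2"
    using clique assms(2) by (auto simp: card_2_iff clique_def nonedge_def)
  then have "card S = 3"
    using card_clique[OF clique] two_le_card_nonface[OF assms(2)] by linarith
  then obtain v w\<^sub>3 w\<^sub>4 where S: "S = {v, w\<^sub>3, w\<^sub>4}" and dist: "v \<noteq> w\<^sub>3" "v \<noteq> w\<^sub>4" "w\<^sub>3 \<noteq> w\<^sub>4"
    by (auto simp: card_3_iff)
  obtain w\<^sub>1 w\<^sub>2 where w: "nbrs v = {w\<^sub>1, w\<^sub>2}" "w\<^sub>1 \<noteq> w\<^sub>2"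
    using seven_vertices(2)[OF assms(1), of v] by (auto simp: card_2_iff)
  have nonedge_v: "nonedge v u \<longleftrightarrow> u = w\<^sub>1 \<or> u = w\<^sub>2" for u
    using w(1) by (auto simp: nbrs_def)
  have edge: "\<not> nonedge v w\<^sub>3" "\<not> nonedge v w\<^sub>4" "\<not> nonedge w\<^sub>3 w\<^sub>4"
    using clique unfolding S clique_def by auto
  have dist': "distinct [v, w\<^sub>1, w\<^sub>2, w\<^sub>3, w\<^sub>4]"
    using dist w(2) edge nonedge_v[of w\<^sub>1] nonedge_v[of w\<^sub>2] by auto
  define W where "W = {w\<^sub>1, w\<^sub>2, w\<^sub>3, w\<^sub>4}"
  have W: "card W = 4" "v \<notin> W" using dist' by (auto simp: W_def)
  define a where "a x = 2 * of_bool (x = v) + (of_bool (x \<in> W) :: nat)" for x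
  have sum_a: "sum a X = 2 * of_bool (v \<in> X) + card (X \<inter> W)" for X
    by (simp add: a_def[abs_def] sum.distrib sum_distrib_left[symmetric])
  have six: "sum a UNIV = 6" using W by (simp add: sum_a)
  have light: "sum a F + 3 \<le> sum a UNIV" if F: "F \<in> \<Delta>" for F
  proof (cases "v \<in> F")
    case True
    then have "w\<^sub>1 \<notin> F" "w\<^sub>2 \<notin> F"
      using nonedge_not_face[of v _ F] nonedge_v F by blast+
    moreover have "\<not> (w\<^sub>3 \<in> F \<and> w\<^sub>4 \<in> F)"
      using subset_face[OF F, of S] assms(2) True S by blast
    ultimately have "F \<inter> W \<subseteq> {w\<^sub>3} \<or> F \<inter> W \<subseteq> {w\<^sub>4}"
      by (auto simp: W_def)
    then have "card (F \<inter> W) \<le> 1"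
      using card_mono[of "{w\<^sub>3}" "F \<inter> W"] card_mono[of "{w\<^sub>4}" "F \<inter> W"] by auto
    then show ?thesis using True six by (simp add: sum_a)
  next
    case False
    have "card (F \<inter> W) \<le> card F" by (intro card_mono) auto
    then show ?thesis using False six card_face[OF F] by (simp add: sum_a)
  qed
  show False
  proof (rule light_weight_decomposition[OF light])
    fix S\<^sub>1 S\<^sub>2 S\<^sub>3
    assume nf: "S\<^sub>1 \<notin> \<Delta>" "S\<^sub>2 \<notin> \<Delta>" "S\<^sub>3 \<notin> \<Delta>"
      and c: "card S\<^sub>1 = 2" "card S\<^sub>2 = 2" "card S\<^sub>3 = 2"
      and a: "\<And>x. a x = of_bool (x \<in> S\<^sub>1) + of_bool (x \<in> S\<^sub>2) + of_bool (x \<in> S\<^sub>3)"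
    have "a v = 2" "a w\<^sub>3 = 1" "a w\<^sub>4 = 1"
      using dist' by (auto simp: a_def W_def)
    note vals = this
    have two: "of_bool (v \<in> S\<^sub>1) + of_bool (v \<in> S\<^sub>2) + of_bool (v \<in> S\<^sub>3) = (2 :: nat)"
      using vals(1) a[of v] by linarith
    have w3: "w\<^sub>3 \<in> S\<^sub>1 \<or> w\<^sub>3 \<in> S\<^sub>2 \<or> w\<^sub>3 \<in> S\<^sub>3"
      by (rule ccontr) (use vals(2) a[of w\<^sub>3] in simp)
    have w4: "w\<^sub>4 \<in> S\<^sub>1 \<or> w\<^sub>4 \<in> S\<^sub>2 \<or> w\<^sub>4 \<in> S\<^sub>3"
      by (rule ccontr) (use vals(3) a[of w\<^sub>4] in simp)
    have pair: "\<not> (x \<in> T \<and> y \<in> T)"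
      if T: "T \<notin> \<Delta>" "card T = 2" and xy: "x \<noteq> y" "\<not> nonedge x y" for T x y
    proof
      assume "x \<in> T \<and> y \<in> T"
      then have "{x, y} = T"
        using T(2) xy(1) by (intro card_subset_eq) auto
      then show False using T(1) xy(2) by (simp add: nonedge_def)
    qed
    note p = pair[OF nf(1) c(1)] pair[OF nf(2) c(2)] pair[OF nf(3) c(3)]
    have "\<not> (v \<in> T \<and> w\<^sub>3 \<in> T) \<and> \<not> (v \<in> T \<and> w\<^sub>4 \<in> T) \<and> \<not> (w\<^sub>3 \<in> T \<and> w\<^sub>4 \<in> T)"
      if "T \<in> {S\<^sub>1, S\<^sub>2, S\<^sub>3}" for T
      using that p dist edge by blast
    from this[of S\<^sub>1] this[of S\<^sub>2] this[of S\<^sub>3] show False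
      using two w3 w4 by (simp add: of_bool_def split: if_splits)
  qed (simp_all add: six)
qed

lemma other_neighbour:
  assumes "7 \<le> CARD('a)" "nonedge v u"
  obtains w where "w \<noteq> u" "\<And>x. nonedge v x \<longleftrightarrow> x = u \<or> x = w"
proof -
  have "card (nbrs v) = 2" "u \<in> nbrs v"
    using seven_vertices(2)[OF assms(1)] assms(2) by (auto simp: nbrs_def)
  then obtain x y where "nbrs v = {x, y}" "x \<noteq> y" "u = x \<or> u = y"
    by (auto simp: card_2_iff)
  then have "\<exists>w. w \<noteq> u \<and> nbrs v = {u, w}"
    by (metis insert_commute)
  then show thesis using that by (auto simp: nbrs_def set_eq_iff)
qed

text \<open>Seven is not a sum of two or more cycle lengths unless one is three, so a triangle-free
  2-regular graph is a single cycle. It is found by walking from one vertex in both directions and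
  excluding each coincidence.\<close>

lemma heptagon:
  assumes "7 \<le> CARD('a)"
  obtains v\<^sub>1 v\<^sub>2 v\<^sub>3 v\<^sub>4 v\<^sub>5 v\<^sub>6 v\<^sub>7 where "(UNIV :: 'a set) = {v\<^sub>1, v\<^sub>2, v\<^sub>3, v\<^sub>4, v\<^sub>5, v\<^sub>6, v\<^sub>7}"
    "distinct [v\<^sub>1, v\<^sub>2, v\<^sub>3, v\<^sub>4, v\<^sub>5, v\<^sub>6, v\<^sub>7]"
    "\<And>x. nonedge v\<^sub>1 x \<longleftrightarrow> x = v\<^sub>2 \<or> x = v\<^sub>7" "\<And>x. nonedge v\<^sub>2 x \<longleftrightarrow> x = v\<^sub>1 \<or> x = v\<^sub>3"
    "\<And>x. nonedge v\<^sub>3 x \<longleftrightarrow> x = v\<^sub>2 \<or> x = v\<^sub>4" "\<And>x. nonedge v\<^sub>4 x \<longleftrightarrow> x = v\<^sub>3 \<or> x = v\<^sub>5"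
    "\<And>x. nonedge v\<^sub>5 x \<longleftrightarrow> x = v\<^sub>6 \<or> x = v\<^sub>4" "\<And>x. nonedge v\<^sub>6 x \<longleftrightarrow> x = v\<^sub>7 \<or> x = v\<^sub>5"
    "\<And>x. nonedge v\<^sub>7 x \<longleftrightarrow> x = v\<^sub>1 \<or> x = v\<^sub>6"
proof -
  note other = other_neighbour[OF assms]
  \<comment> \<open>A closed set of four or six vertices would leave three or one. Degree two makes
    three vertices a triangle and is impossible on a single vertex.\<close>
  have closed: "card X \<notin> {4, 6}"
    if X: "\<And>x y. x \<in> X \<Longrightarrow> nonedge x y \<Longrightarrow> y \<in> X" for X
  proof
    assume card_X: "card X \<in> {4, 6}"
    have card_Y: "card (- X) = 7 - card X"
      using seven_vertices(1)[OF assms] by (simp add: Compl_eq_Diff_UNIV card_Diff_subset)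
    have Y: "nbrs y \<subseteq> - X - {y}" if "y \<in> - X" for y
      using that X[of _ y] nonedge_sym by (auto simp: nbrs_def)
    have nbrs_Y: "nbrs y = - X - {y} \<and> card (- X) = 3" if "y \<in> - X" for y
    proof -
      have "card (- X - {y}) = card (- X) - 1"
        using that by simp
      moreover have "2 \<le> card (- X - {y})"
        using card_mono[OF _ Y[OF that]] seven_vertices(2)[OF assms, of y] by simp
      ultimately show ?thesis
        using card_X card_Y card_seteq[OF _ Y[OF that]] seven_vertices(2)[OF assms, of y] by auto
    qed
    have "- X \<noteq> {}" using card_X card_Y by auto
    then have "card (- X) = 3" using nbrs_Y by blast
    then obtain x y z where xyz: "- X = {x, y, z}" "x \<noteq> y" "y \<noteq> z" "x \<noteq> z"
      by (auto simp: card_3_iff)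
    then have "y \<in> nbrs x" "z \<in> nbrs x" "z \<in> nbrs y"
      using nbrs_Y[of x] nbrs_Y[of y] by auto
    then show False
      using no_triangle by (auto simp: nbrs_def)
  qed
  fix v\<^sub>1 :: 'a
  obtain v\<^sub>2 where "nonedge v\<^sub>1 v\<^sub>2"
    using seven_vertices(2)[OF assms, of v\<^sub>1] by (auto simp: nbrs_def card_2_iff)
  then obtain v\<^sub>7 where 1: "v\<^sub>7 \<noteq> v\<^sub>2" "\<And>x. nonedge v\<^sub>1 x \<longleftrightarrow> x = v\<^sub>2 \<or> x = v\<^sub>7"
    by (rule other) blast
  obtain v\<^sub>3 where 2: "v\<^sub>3 \<noteq> v\<^sub>1" "\<And>x. nonedge v\<^sub>2 x \<longleftrightarrow> x = v\<^sub>1 \<or> x = v\<^sub>3"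
    by (rule other[of v\<^sub>2 v\<^sub>1]) (use 1 nonedge_sym in blast)+
  obtain v\<^sub>6 where 7: "v\<^sub>6 \<noteq> v\<^sub>1" "\<And>x. nonedge v\<^sub>7 x \<longleftrightarrow> x = v\<^sub>1 \<or> x = v\<^sub>6"
    by (rule other[of v\<^sub>7 v\<^sub>1]) (use 1 nonedge_sym in blast)+
  obtain v\<^sub>4 where 3: "v\<^sub>4 \<noteq> v\<^sub>2" "\<And>x. nonedge v\<^sub>3 x \<longleftrightarrow> x = v\<^sub>2 \<or> x = v\<^sub>4"
    by (rule other[of v\<^sub>3 v\<^sub>2]) (use 2 nonedge_sym in blast)+
  obtain v\<^sub>5 where 6: "v\<^sub>5 \<noteq> v\<^sub>7" "\<And>x. nonedge v\<^sub>6 x \<longleftrightarrow> x = v\<^sub>7 \<or> x = v\<^sub>5"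
    by (rule other[of v\<^sub>6 v\<^sub>7]) (use 7 nonedge_sym in blast)+
  have d1: "v\<^sub>1 \<noteq> v\<^sub>2" "v\<^sub>1 \<noteq> v\<^sub>7" "v\<^sub>2 \<noteq> v\<^sub>3" "v\<^sub>7 \<noteq> v\<^sub>6" "v\<^sub>3 \<noteq> v\<^sub>4" "v\<^sub>6 \<noteq> v\<^sub>5"
    using 1 2 3 6 7 nonedge_irrefl by metis+
  have d2: "v\<^sub>3 \<noteq> v\<^sub>7" "v\<^sub>6 \<noteq> v\<^sub>2"
    using no_triangle[of v\<^sub>1 v\<^sub>2 v\<^sub>7] 1 2 7 nonedge_sym by blast+
  \<comment> \<open>A coincidence here would close the walk to a four-cycle.\<close>
  have d3: "v\<^sub>3 \<noteq> v\<^sub>6"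
  proof
    assume "v\<^sub>3 = v\<^sub>6"
    then have "v\<^sub>4 = v\<^sub>7" using 3(2)[of v\<^sub>7] 6(2)[of v\<^sub>7] d2 1(1) by auto
    then have "card {v\<^sub>1, v\<^sub>2, v\<^sub>3, v\<^sub>7} \<notin> {4, 6}"
      using 1 2 3 7 \<open>v\<^sub>3 = v\<^sub>6\<close> by (intro closed) auto
    then show False using 1(1) 2(1) d1 d2 by auto
  qed
  have d4: "v\<^sub>4 \<noteq> v\<^sub>1" "v\<^sub>5 \<noteq> v\<^sub>1"
    using 3(2)[of v\<^sub>1] 6(2)[of v\<^sub>1] 1(2)[of v\<^sub>3] 1(2)[of v\<^sub>6] d1 d2
      nonedge_sym[of v\<^sub>3 v\<^sub>1] nonedge_sym[of v\<^sub>6 v\<^sub>1] by auto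
  have d5: "v\<^sub>4 \<noteq> v\<^sub>7" "v\<^sub>5 \<noteq> v\<^sub>2"
    using 3(2)[of v\<^sub>7] 6(2)[of v\<^sub>2] 7(2)[of v\<^sub>3] 2(2)[of v\<^sub>6] 2(1) 7(1) d3
      nonedge_sym[of v\<^sub>3 v\<^sub>7] nonedge_sym[of v\<^sub>6 v\<^sub>2] by auto
  have d6: "v\<^sub>4 \<noteq> v\<^sub>6" "v\<^sub>5 \<noteq> v\<^sub>3"
  proof -
    have "\<not> nonedge v\<^sub>3 v\<^sub>6"
    proof
      assume "nonedge v\<^sub>3 v\<^sub>6"
      moreover have "distinct [v\<^sub>1, v\<^sub>2, v\<^sub>3, v\<^sub>6, v\<^sub>7]" using 1(1) 2(1) 7(1) d1 d2 d3 by auto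
      ultimately show False
        by (intro no_pentagon[of v\<^sub>1 v\<^sub>2 v\<^sub>3 v\<^sub>6 v\<^sub>7]) (use 1 2 6 7 in auto)
    qed
    then show "v\<^sub>4 \<noteq> v\<^sub>6" "v\<^sub>5 \<noteq> v\<^sub>3"
      using 3(2)[of v\<^sub>4] 6(2)[of v\<^sub>5] nonedge_sym by blast+
  qed
  have n43: "nonedge v\<^sub>4 v\<^sub>3" "nonedge v\<^sub>5 v\<^sub>6" using 3 6 nonedge_sym by blast+
  \<comment> \<open>A coincidence here would close the walk to a six-cycle.\<close>
  have d7: "v\<^sub>4 \<noteq> v\<^sub>5"
  proof
    assume eq: "v\<^sub>4 = v\<^sub>5"
    obtain w where w: "w \<noteq> v\<^sub>3" "\<And>x. nonedge v\<^sub>4 x \<longleftrightarrow> x = v\<^sub>3 \<or> x = w"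
      by (rule other[OF n43(1)]) blast
    then have "w = v\<^sub>6" using n43(2) eq d3 by auto
    then have "card {v\<^sub>1, v\<^sub>2, v\<^sub>3, v\<^sub>4, v\<^sub>6, v\<^sub>7} \<notin> {4, 6}"
      using 1 2 3 6 7 w eq by (intro closed) auto
    then show False using 1(1) 2(1) 3(1) 7(1) d1 d2 d3 d4 d5 d6 by auto
  qed
  have dist: "distinct [v\<^sub>1, v\<^sub>2, v\<^sub>3, v\<^sub>4, v\<^sub>5, v\<^sub>6, v\<^sub>7]"
    using 1(1) 2(1) 3(1) 6(1) 7(1) d1 d2 d3 d4 d5 d6 d7 by auto
  then have "card {v\<^sub>1, v\<^sub>2, v\<^sub>3, v\<^sub>4, v\<^sub>5, v\<^sub>6, v\<^sub>7} = 7" by simp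
  then have UNIV: "(UNIV :: 'a set) = {v\<^sub>1, v\<^sub>2, v\<^sub>3, v\<^sub>4, v\<^sub>5, v\<^sub>6, v\<^sub>7}"
    using seven_vertices(1)[OF assms] card_subset_eq[of UNIV "{v\<^sub>1, v\<^sub>2, v\<^sub>3, v\<^sub>4, v\<^sub>5, v\<^sub>6, v\<^sub>7}"] by simp
  obtain y where y: "y \<noteq> v\<^sub>3" "\<And>x. nonedge v\<^sub>4 x \<longleftrightarrow> x = v\<^sub>3 \<or> x = y"
    by (rule other[OF n43(1)]) blast
  obtain z where z: "z \<noteq> v\<^sub>6" "\<And>x. nonedge v\<^sub>5 x \<longleftrightarrow> x = v\<^sub>6 \<or> x = z"
    by (rule other[OF n43(2)]) blast
  \<comment> \<open>The vertices \<open>v\<^sub>1\<close>, \<open>v\<^sub>2\<close>,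
    \<open>v\<^sub>6\<close> and \<open>v\<^sub>7\<close> already have their two neighbours, so only
    \<open>v\<^sub>5\<close> remains for \<open>y\<close>.\<close>
  have "y \<in> {v\<^sub>1, v\<^sub>2, v\<^sub>3, v\<^sub>4, v\<^sub>5, v\<^sub>6, v\<^sub>7}" using UNIV by blast
  moreover have "nonedge y v\<^sub>4" using y nonedge_sym by blast
  ultimately have "y = v\<^sub>5"
    using y(1) 1(2)[of v\<^sub>4] 2(2)[of v\<^sub>4] 6(2)[of v\<^sub>4] 7(2)[of v\<^sub>4] dist by auto
  then have "z = v\<^sub>4"
    using y(2)[of v\<^sub>5] z(2)[of v\<^sub>4] nonedge_sym[of v\<^sub>4 v\<^sub>5] dist by auto
  show thesis
    by (rule that[OF UNIV dist 1(2) 2(2) 3(2) y(2)[unfolded \<open>y = v\<^sub>5\<close>] z(2)[unfolded \<open>z = v\<^sub>4\<close>] 6(2) 7(2)])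
qed

lemma seven_vertices_nonfaces:
  assumes "7 \<le> CARD('a)"
  obtains v\<^sub>1 v\<^sub>2 v\<^sub>3 v\<^sub>4 v\<^sub>5 v\<^sub>6 v\<^sub>7 where "(UNIV :: 'a set) = {v\<^sub>1, v\<^sub>2, v\<^sub>3, v\<^sub>4, v\<^sub>5, v\<^sub>6, v\<^sub>7}"
    "distinct [v\<^sub>1, v\<^sub>2, v\<^sub>3, v\<^sub>4, v\<^sub>5, v\<^sub>6, v\<^sub>7]"
    "\<And>S. S \<notin> \<Delta> \<longleftrightarrow> (\<exists>e\<in>{{v\<^sub>1, v\<^sub>2}, {v\<^sub>2, v\<^sub>3}, {v\<^sub>3, v\<^sub>4}, {v\<^sub>4, v\<^sub>5}, {v\<^sub>5, v\<^sub>6}, {v\<^sub>6, v\<^sub>7}, {v\<^sub>7, v\<^sub>1}}. e \<subseteq> S)"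
proof (rule heptagon[OF assms])
  fix v\<^sub>1 v\<^sub>2 v\<^sub>3 v\<^sub>4 v\<^sub>5 v\<^sub>6 v\<^sub>7 assume v: "(UNIV :: 'a set) = {v\<^sub>1, v\<^sub>2, v\<^sub>3, v\<^sub>4, v\<^sub>5, v\<^sub>6, v\<^sub>7}"
    "distinct [v\<^sub>1, v\<^sub>2, v\<^sub>3, v\<^sub>4, v\<^sub>5, v\<^sub>6, v\<^sub>7]"
    and n: "\<And>x. nonedge v\<^sub>1 x \<longleftrightarrow> x = v\<^sub>2 \<or> x = v\<^sub>7" "\<And>x. nonedge v\<^sub>2 x \<longleftrightarrow> x = v\<^sub>1 \<or> x = v\<^sub>3"
    "\<And>x. nonedge v\<^sub>3 x \<longleftrightarrow> x = v\<^sub>2 \<or> x = v\<^sub>4" "\<And>x. nonedge v\<^sub>4 x \<longleftrightarrow> x = v\<^sub>3 \<or> x = v\<^sub>5"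
    "\<And>x. nonedge v\<^sub>5 x \<longleftrightarrow> x = v\<^sub>6 \<or> x = v\<^sub>4" "\<And>x. nonedge v\<^sub>6 x \<longleftrightarrow> x = v\<^sub>7 \<or> x = v\<^sub>5"
    "\<And>x. nonedge v\<^sub>7 x \<longleftrightarrow> x = v\<^sub>1 \<or> x = v\<^sub>6"
  let ?E = "{{v\<^sub>1, v\<^sub>2}, {v\<^sub>2, v\<^sub>3}, {v\<^sub>3, v\<^sub>4}, {v\<^sub>4, v\<^sub>5}, {v\<^sub>5, v\<^sub>6}, {v\<^sub>6, v\<^sub>7}, {v\<^sub>7, v\<^sub>1}}"
  have "\<exists>e\<in>?E. e \<subseteq> S" if S: "S \<notin> \<Delta>" for S
  proof -
    obtain x y where xy: "x \<in> S" "y \<in> S" "nonedge x y"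
      using nonface_contains_nonedge[OF assms S] by blast
    have "x \<in> {v\<^sub>1, v\<^sub>2, v\<^sub>3, v\<^sub>4, v\<^sub>5, v\<^sub>6, v\<^sub>7}" using v(1) by blast
    then consider "x = v\<^sub>1" | "x = v\<^sub>2" | "x = v\<^sub>3" | "x = v\<^sub>4" | "x = v\<^sub>5" | "x = v\<^sub>6" | "x = v\<^sub>7"
      by blast
    then have "{x, y} \<in> ?E"
      using xy(3) by cases (auto simp: n doubleton_eq_iff)
    moreover have "{x, y} \<subseteq> S" using xy(1,2) by simp
    ultimately show ?thesis by (rule bexI[rotated])
  qed
  moreover have "e \<notin> \<Delta>" if "e \<in> ?E" for e
  proof -
    have "{v\<^sub>1, v\<^sub>2} \<notin> \<Delta>" "{v\<^sub>2, v\<^sub>3} \<notin> \<Delta>" "{v\<^sub>3, v\<^sub>4} \<notin> \<Delta>" "{v\<^sub>4, v\<^sub>5} \<notin> \<Delta>" "{v\<^sub>5, v\<^sub>6} \<notin> \<Delta>"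
      "{v\<^sub>6, v\<^sub>7} \<notin> \<Delta>" "{v\<^sub>7, v\<^sub>1} \<notin> \<Delta>"
      unfolding nonedge_def[symmetric] by (simp_all add: n)
    then show ?thesis using that by auto
  qed
  then have "S \<notin> \<Delta>" if "\<exists>e\<in>?E. e \<subseteq> S" for S
    using that by (elim bexE) (use subset_face in metis)
  ultimately have "S \<notin> \<Delta> \<longleftrightarrow> (\<exists>e\<in>?E. e \<subseteq> S)" for S
    by (rule iffI)
  then show thesis
    by (rule that[OF v])
qed

text \<open>For every vertex \<open>w\<close> some face of three vertices avoids \<open>w\<close>;
  containing no matched pair, it picks one vertex from each. These transversals together with the
  absence of triangles in \<open>G\<close> force two complementary transversals to be
  cliques.\<close>

lemma six_vertices_two_triangles:
  assumes UNIV: "(UNIV :: 'a set) = {p\<^sub>1, q\<^sub>1, p\<^sub>2, q\<^sub>2, p\<^sub>3, q\<^sub>3}"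
    and dist: "distinct [p\<^sub>1, q\<^sub>1, p\<^sub>2, q\<^sub>2, p\<^sub>3, q\<^sub>3]"
    and pq: "{p\<^sub>1, q\<^sub>1} \<notin> \<Delta>" "{p\<^sub>2, q\<^sub>2} \<notin> \<Delta>" "{p\<^sub>3, q\<^sub>3} \<notin> \<Delta>"
  obtains T where "card T = 3" "clique T" "card (- T) = 3" "clique (- T)"
proof -
  have nonedge_pq: "nonedge p\<^sub>1 q\<^sub>1" "nonedge p\<^sub>2 q\<^sub>2" "nonedge p\<^sub>3 q\<^sub>3"
    using pq by (auto simp: nonedge_def)
  have avoid: "\<exists>x\<in>{p\<^sub>1, q\<^sub>1}. \<exists>y\<in>{p\<^sub>2, q\<^sub>2}. \<exists>z\<in>{p\<^sub>3, q\<^sub>3}. x \<noteq> w \<and> y \<noteq> w \<and> z \<noteq> w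
      \<and> \<not> nonedge x y \<and> \<not> nonedge x z \<and> \<not> nonedge y z" for w
  proof -
    have "card (UNIV :: 'a set) = 6" by (subst UNIV) (use dist in simp)
    then have "card (- {w}) = 5" by (simp add: Compl_eq_Diff_UNIV)
    then obtain F where F: "F \<in> \<Delta>" "F \<subseteq> - {w}" "card F = 3"
      using five_set_face by blast
    have no: "\<not> {p\<^sub>1, q\<^sub>1} \<subseteq> F" "\<not> {p\<^sub>2, q\<^sub>2} \<subseteq> F" "\<not> {p\<^sub>3, q\<^sub>3} \<subseteq> F"
      using pq F(1) subset_face by blast+
    have small: "\<not> F \<subseteq> {x, y}" for x y
    proof
      assume "F \<subseteq> {x, y}"
      then have "card F \<le> card {x, y}" by (intro card_mono) auto
      also have "\<dots> \<le> 2" by (simp add: card_insert_if)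
      finally show False using F(3) by simp
    qed
    have F_sub: "F \<subseteq> {p\<^sub>1, q\<^sub>1} \<union> {p\<^sub>2, q\<^sub>2} \<union> {p\<^sub>3, q\<^sub>3}" using UNIV by blast
    have "{p\<^sub>1, q\<^sub>1} \<inter> F \<noteq> {}"
      using no small[of p\<^sub>2 p\<^sub>3] small[of p\<^sub>2 q\<^sub>3] small[of q\<^sub>2 p\<^sub>3] small[of q\<^sub>2 q\<^sub>3] F_sub by blast
    moreover have "{p\<^sub>2, q\<^sub>2} \<inter> F \<noteq> {}"
      using no small[of p\<^sub>1 p\<^sub>3] small[of p\<^sub>1 q\<^sub>3] small[of q\<^sub>1 p\<^sub>3] small[of q\<^sub>1 q\<^sub>3] F_sub by blast
    moreover have "{p\<^sub>3, q\<^sub>3} \<inter> F \<noteq> {}"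
      using no small[of p\<^sub>1 p\<^sub>2] small[of p\<^sub>1 q\<^sub>2] small[of q\<^sub>1 p\<^sub>2] small[of q\<^sub>1 q\<^sub>2] F_sub by blast
    ultimately obtain x y z where xyz: "x \<in> {p\<^sub>1, q\<^sub>1} \<inter> F" "y \<in> {p\<^sub>2, q\<^sub>2} \<inter> F" "z \<in> {p\<^sub>3, q\<^sub>3} \<inter> F"
      by blast
    then have "\<not> nonedge x y \<and> \<not> nonedge x z \<and> \<not> nonedge y z"
      using F(1) nonedge_not_face by blast
    moreover have "x \<in> {p\<^sub>1, q\<^sub>1}" "y \<in> {p\<^sub>2, q\<^sub>2}" "z \<in> {p\<^sub>3, q\<^sub>3}" "x \<noteq> w" "y \<noteq> w" "z \<noteq> w"
      using xyz F(2) by auto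
    ultimately show ?thesis
      by (intro bexI[of _ x] bexI[of _ y] bexI[of _ z] conjI) simp_all
  qed
  have tri: "\<not> nonedge x y \<or> \<not> nonedge y z \<or> \<not> nonedge x z" for x y z
    using no_triangle by blast
  let ?clique = "\<lambda>x y z. \<not> nonedge x y \<and> \<not> nonedge x z \<and> \<not> nonedge y z"
  have av1: "?clique q\<^sub>1 p\<^sub>2 p\<^sub>3 \<or> ?clique q\<^sub>1 p\<^sub>2 q\<^sub>3
    \<or> ?clique q\<^sub>1 q\<^sub>2 p\<^sub>3 \<or> ?clique q\<^sub>1 q\<^sub>2 q\<^sub>3"
    using avoid[of p\<^sub>1] by simp argo
  have av2: "?clique p\<^sub>1 p\<^sub>2 p\<^sub>3 \<or> ?clique p\<^sub>1 p\<^sub>2 q\<^sub>3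
    \<or> ?clique p\<^sub>1 q\<^sub>2 p\<^sub>3 \<or> ?clique p\<^sub>1 q\<^sub>2 q\<^sub>3"
    using avoid[of q\<^sub>1] by simp argo
  have av3: "?clique p\<^sub>1 q\<^sub>2 p\<^sub>3 \<or> ?clique p\<^sub>1 q\<^sub>2 q\<^sub>3
    \<or> ?clique q\<^sub>1 q\<^sub>2 p\<^sub>3 \<or> ?clique q\<^sub>1 q\<^sub>2 q\<^sub>3"
    using avoid[of p\<^sub>2] by simp argo
  have av4: "?clique p\<^sub>1 p\<^sub>2 p\<^sub>3 \<or> ?clique p\<^sub>1 p\<^sub>2 q\<^sub>3
    \<or> ?clique q\<^sub>1 p\<^sub>2 p\<^sub>3 \<or> ?clique q\<^sub>1 p\<^sub>2 q\<^sub>3"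
    using avoid[of q\<^sub>2] by simp argo
  have av5: "?clique p\<^sub>1 p\<^sub>2 q\<^sub>3 \<or> ?clique p\<^sub>1 q\<^sub>2 q\<^sub>3
    \<or> ?clique q\<^sub>1 p\<^sub>2 q\<^sub>3 \<or> ?clique q\<^sub>1 q\<^sub>2 q\<^sub>3"
    using avoid[of p\<^sub>3] by simp argo
  have av6: "?clique p\<^sub>1 p\<^sub>2 p\<^sub>3 \<or> ?clique p\<^sub>1 q\<^sub>2 p\<^sub>3
    \<or> ?clique q\<^sub>1 p\<^sub>2 p\<^sub>3 \<or> ?clique q\<^sub>1 q\<^sub>2 p\<^sub>3"
    using avoid[of q\<^sub>3] by simp argo
  \<comment> \<open>A propositional consequence with the nonedges as atoms. All instances of
    \<open>tri\<close> list vertices in the same order, so symmetry of \<open>nonedge\<close> does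
    not intervene.\<close>
  have split: "(?clique p\<^sub>1 p\<^sub>2 p\<^sub>3 \<and> ?clique q\<^sub>1 q\<^sub>2 q\<^sub>3) \<or> (?clique p\<^sub>1 p\<^sub>2 q\<^sub>3 \<and> ?clique q\<^sub>1 q\<^sub>2 p\<^sub>3)
    \<or> (?clique p\<^sub>1 q\<^sub>2 p\<^sub>3 \<and> ?clique q\<^sub>1 p\<^sub>2 q\<^sub>3) \<or> (?clique p\<^sub>1 q\<^sub>2 q\<^sub>3 \<and> ?clique q\<^sub>1 p\<^sub>2 p\<^sub>3)"
    using av1 av2 av3 av4 av5 av6 nonedge_pq
      tri[of p\<^sub>1 p\<^sub>2 q\<^sub>2] tri[of q\<^sub>1 p\<^sub>2 q\<^sub>2] tri[of p\<^sub>1 p\<^sub>3 q\<^sub>3] tri[of q\<^sub>1 p\<^sub>3 q\<^sub>3]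
      tri[of p\<^sub>1 q\<^sub>1 p\<^sub>2] tri[of p\<^sub>1 q\<^sub>1 q\<^sub>2] tri[of p\<^sub>2 p\<^sub>3 q\<^sub>3] tri[of q\<^sub>2 p\<^sub>3 q\<^sub>3]
      tri[of p\<^sub>1 q\<^sub>1 p\<^sub>3] tri[of p\<^sub>1 q\<^sub>1 q\<^sub>3] tri[of p\<^sub>2 q\<^sub>2 p\<^sub>3] tri[of p\<^sub>2 q\<^sub>2 q\<^sub>3]
      tri[of p\<^sub>1 p\<^sub>2 p\<^sub>3] tri[of p\<^sub>1 p\<^sub>2 q\<^sub>3] tri[of p\<^sub>1 q\<^sub>2 p\<^sub>3] tri[of p\<^sub>1 q\<^sub>2 q\<^sub>3]
      tri[of q\<^sub>1 p\<^sub>2 p\<^sub>3] tri[of q\<^sub>1 p\<^sub>2 q\<^sub>3] tri[of q\<^sub>1 q\<^sub>2 p\<^sub>3] tri[of q\<^sub>1 q\<^sub>2 q\<^sub>3]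
    by argo
  then show thesis
  proof (elim disjE)
    assume "?clique p\<^sub>1 p\<^sub>2 p\<^sub>3 \<and> ?clique q\<^sub>1 q\<^sub>2 q\<^sub>3"
    moreover have "- {p\<^sub>1, p\<^sub>2, p\<^sub>3} = {q\<^sub>1, q\<^sub>2, q\<^sub>3}" using UNIV dist by auto
    ultimately show thesis
      by (intro that[of "{p\<^sub>1, p\<^sub>2, p\<^sub>3}"]) (use dist nonedge_sym in \<open>auto simp: clique_def\<close>)
  next
    assume "?clique p\<^sub>1 p\<^sub>2 q\<^sub>3 \<and> ?clique q\<^sub>1 q\<^sub>2 p\<^sub>3"
    moreover have "- {p\<^sub>1, p\<^sub>2, q\<^sub>3} = {q\<^sub>1, q\<^sub>2, p\<^sub>3}" using UNIV dist by auto
    ultimately show thesis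
      by (intro that[of "{p\<^sub>1, p\<^sub>2, q\<^sub>3}"]) (use dist nonedge_sym in \<open>auto simp: clique_def\<close>)
  next
    assume "?clique p\<^sub>1 q\<^sub>2 p\<^sub>3 \<and> ?clique q\<^sub>1 p\<^sub>2 q\<^sub>3"
    moreover have "- {p\<^sub>1, q\<^sub>2, p\<^sub>3} = {q\<^sub>1, p\<^sub>2, q\<^sub>3}" using UNIV dist by auto
    ultimately show thesis
      by (intro that[of "{p\<^sub>1, q\<^sub>2, p\<^sub>3}"]) (use dist nonedge_sym in \<open>auto simp: clique_def\<close>)
  next
    assume "?clique p\<^sub>1 q\<^sub>2 q\<^sub>3 \<and> ?clique q\<^sub>1 p\<^sub>2 p\<^sub>3"
    moreover have "- {p\<^sub>1, q\<^sub>2, q\<^sub>3} = {q\<^sub>1, p\<^sub>2, p\<^sub>3}" using UNIV dist by auto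
    ultimately show thesis
      by (intro that[of "{p\<^sub>1, q\<^sub>2, q\<^sub>3}"]) (use dist nonedge_sym in \<open>auto simp: clique_def\<close>)
  qed
qed

end

section \<open>Translation between the stated ideals and the combinatorial data\<close>

lemma squarefree_ideal_heptagon:
  assumes "inj_on x {1..7::nat}"
  shows "squarefree_ideal {{x 1, x 2}, {x 2, x 3}, {x 3, x 4}, {x 4, x 5}, {x 5, x 6}, {x 6, x 7}, {x 7, x 1}}
    = (ideal.span {var (x 1) * var (x 2), var (x 2) * var (x 3), var (x 3) * var (x 4),
        var (x 4) * var (x 5), var (x 5) * var (x 6), var (x 6) * var (x 7), var (x 7) * var (x 1)}
      :: ('v, 'k::field) mpoly set)"
proof -
  have neq: "x i \<noteq> x j" if "i \<in> {1..7}" "j \<in> {1..7}" "i \<noteq> j" for i j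
    using inj_onD[OF assms] that by blast
  show ?thesis
    unfolding squarefree_ideal_def setcompr_eq_image Collect_mem_eq
    by (simp add: neq)
qed

text \<open>A face \<open>B\<close> of largest dimension is a facet with three vertices, and purity
  transfers this size to a facet above any given face.\<close>

lemma pure_two_complexI:
  fixes \<Delta> :: "'v::finite set set"
  assumes "simplicial_complex \<Delta>" "pure_complex \<Delta>" "complex_dim \<Delta> = 2"
  shows "pure_two_complex \<Delta>"
proof
  show subset: "G \<in> \<Delta>" if "F \<in> \<Delta>" "G \<subseteq> F" for F G
    using assms(1) that unfolding simplicial_complex_def by blast
  show vertex: "{v} \<in> \<Delta>" for v
    using assms(1) by (simp add: simplicial_complex_def)
  have "\<Delta> \<noteq> {}" using vertex by blast
  then have "complex_dim \<Delta> \<in> face_dim ` \<Delta>"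
    unfolding complex_dim_def by (intro Max_in) auto
  then obtain B where B: "B \<in> \<Delta>" "face_dim B = 2"
    unfolding assms(3) by auto
  have dim_le: "face_dim F \<le> 2" if "F \<in> \<Delta>" for F
    unfolding assms(3)[symmetric] complex_dim_def using that by (intro Max_ge) auto
  have "G = B" if "G \<in> \<Delta>" "B \<subseteq> G" for G
    using card_seteq[OF finite that(2)] dim_le[OF that(1)] B(2) by (simp add: face_dim_def)
  then have facet_B: "B \<in> facets \<Delta>"
    using B(1) by (simp add: facets_def)
  show "\<exists>T\<in>\<Delta>. F \<subseteq> T \<and> card T = 3" if F: "F \<in> \<Delta>" for F
  proof -
    obtain T where T: "T \<in> \<Delta>" "F \<subseteq> T" "\<forall>G\<in>\<Delta>. T \<subseteq> G \<longrightarrow> T = G"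
      using finite_has_maximal2[OF finite F] by (elim bexE conjE)
    have "G = T" if "G \<in> \<Delta>" "T \<subseteq> G" for G
      by (rule T(3)[rule_format, OF that, symmetric])
    then have "T \<in> facets \<Delta>"
      using T(1) by (simp add: facets_def)
    then have "face_dim T = face_dim B"
      by (rule assms(2)[unfolded pure_complex_def, rule_format, OF _ facet_B])
    then have "card T = 3"
      using B(2) by (simp add: face_dim_def)
    then show ?thesis
      using T(1,2) by (intro bexI[of _ T] conjI)
  qed
qed

text \<open>The ordinary power always lies in the symbolic one by \<open>packs_le_sum\<close>, so
  the equivalence of predicates reduces to one implication.\<close>

lemma (in pure_two_complex) symbolic_power_eq_iff_packs:
  "(symbolic_power \<Delta> m :: ('v, 'k::field) mpoly set) = ideal_power (stanley_reisner_ideal \<Delta>) m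
    \<longleftrightarrow> (\<forall>a. (\<forall>F\<in>\<Delta>. m \<le> sum a (- F)) \<longrightarrow> packs (- \<Delta>) m a)"
proof -
  have "m \<le> sum a (- F)" if "packs (- \<Delta>) m a" "F \<in> \<Delta>" for a F
    using that(1)
  proof (rule packs_le_sum)
    show "S \<inter> - F \<noteq> {}" if "S \<in> - \<Delta>" for S
      using subset_face[OF \<open>F \<in> \<Delta>\<close>, of S] that by blast
  qed
  then show ?thesis
    unfolding symbolic_power_eq_iff facet_weights_iff by meson
qed

theorem theorem2p5:
  fixes \<Delta> :: "'v::finite set set"
  assumes "simplicial_complex \<Delta>"
    and "pure_complex \<Delta>"
    and "complex_dim \<Delta> = 2"
    and "CARD('v) \<ge> 6"
  shows "(symbolic_power \<Delta> 3 :: ('v, 'k::field) mpoly set)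
           = ideal_power (stanley_reisner_ideal \<Delta>) 3
     \<longleftrightarrow>
       (CARD('v) = 6
        \<and> (\<exists>e\<^sub>1 \<in> complement_graph (one_skeleton \<Delta>).
            \<exists>e\<^sub>2 \<in> complement_graph (one_skeleton \<Delta>).
            \<exists>e\<^sub>3 \<in> complement_graph (one_skeleton \<Delta>).
              e\<^sub>1 \<inter> e\<^sub>2 = {} \<and> e\<^sub>1 \<inter> e\<^sub>3 = {} \<and> e\<^sub>2 \<inter> e\<^sub>3 = {})
        \<and> (\<exists>T\<^sub>1 \<in> triangles (one_skeleton \<Delta>).
            \<exists>T\<^sub>2 \<in> triangles (one_skeleton \<Delta>). T\<^sub>1 \<inter> T\<^sub>2 = {}))
     \<or> (CARD('v) = 7
        \<and> (\<exists>x :: nat \<Rightarrow> 'v. bij_betw x {1..7} UNIV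
            \<and> (stanley_reisner_ideal \<Delta> :: ('v, 'k) mpoly set) =
              ideal.span {var (x 1) * var (x 2), var (x 2) * var (x 3), var (x 3) * var (x 4),
                var (x 4) * var (x 5), var (x 5) * var (x 6), var (x 6) * var (x 7),
                var (x 7) * var (x 1)}))"
    (is "?eq \<longleftrightarrow> ?six \<or> ?seven")
proof -
  interpret pure_two_complex \<Delta>
    using assms(1-3) by (rule pure_two_complexI)
  have complement_iff: "e \<in> complement_graph (one_skeleton \<Delta>) \<longleftrightarrow> card e = 2 \<and> e \<notin> \<Delta>" for e
    by (auto simp: complement_graph_def one_skeleton_def)
  have eq_iff: "?eq \<longleftrightarrow> (\<forall>a. (\<forall>F\<in>\<Delta>. 3 \<le> sum a (- F)) \<longrightarrow> packs (- \<Delta>) 3 a)"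
    by (rule symbolic_power_eq_iff_packs)
  have ideal_iff: "(stanley_reisner_ideal \<Delta> :: ('v, 'k) mpoly set) = squarefree_ideal E
      \<longleftrightarrow> (\<forall>S. S \<notin> \<Delta> \<longleftrightarrow> (\<exists>e\<in>E. e \<subseteq> S))" for E
    by (rule stanley_reisner_ideal_eq_iff) (rule subset_face)
  show ?thesis
  proof
    assume ?eq
    then interpret cubic_two_complex \<Delta>
      using assms(4) by unfold_locales (simp_all add: eq_iff)
    show "?six \<or> ?seven"
    proof (cases "7 \<le> CARD('v)")
      case True
      obtain v\<^sub>1 v\<^sub>2 v\<^sub>3 v\<^sub>4 v\<^sub>5 v\<^sub>6 v\<^sub>7
        where v: "(UNIV :: 'v set) = {v\<^sub>1, v\<^sub>2, v\<^sub>3, v\<^sub>4, v\<^sub>5, v\<^sub>6, v\<^sub>7}" "distinct [v\<^sub>1, v\<^sub>2, v\<^sub>3, v\<^sub>4, v\<^sub>5, v\<^sub>6, v\<^sub>7]"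
          and nonfaces: "\<forall>S. S \<notin> \<Delta> \<longleftrightarrow> (\<exists>e\<in>{{v\<^sub>1, v\<^sub>2}, {v\<^sub>2, v\<^sub>3}, {v\<^sub>3, v\<^sub>4}, {v\<^sub>4, v\<^sub>5}, {v\<^sub>5, v\<^sub>6}, {v\<^sub>6, v\<^sub>7}, {v\<^sub>7, v\<^sub>1}}. e \<subseteq> S)"
        using seven_vertices_nonfaces[OF True] by (metis (no_types, lifting))
      \<comment> \<open>List positions start at 0, whereas the variables are numbered from
        1.\<close>
      define x where "x i = [v\<^sub>1, v\<^sub>2, v\<^sub>3, v\<^sub>4, v\<^sub>5, v\<^sub>6, v\<^sub>7] ! (i - 1)" for i
      have x: "x 1 = v\<^sub>1" "x 2 = v\<^sub>2" "x 3 = v\<^sub>3" "x 4 = v\<^sub>4" "x 5 = v\<^sub>5" "x 6 = v\<^sub>6" "x 7 = v\<^sub>7"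
        by (simp_all add: x_def)
      have seven: "{1..7::nat} = {1, 2, 3, 4, 5, 6, 7}" by auto
      have image: "x ` {1..7} = UNIV"
        unfolding v(1) seven by (simp only: image_insert image_empty x)
      have card: "CARD('v) = 7"
        by (rule seven_vertices(1)[OF True])
      then have inj: "inj_on x {1..7}"
        using image by (intro eq_card_imp_inj_on) simp_all
      have "(stanley_reisner_ideal \<Delta> :: ('v, 'k) mpoly set)
        = squarefree_ideal {{x 1, x 2}, {x 2, x 3}, {x 3, x 4}, {x 4, x 5}, {x 5, x 6}, {x 6, x 7}, {x 7, x 1}}"
        unfolding ideal_iff x by (rule nonfaces)
      then show ?thesis
        using card image inj unfolding squarefree_ideal_heptagon[OF inj] bij_betw_def by blast
    next
      case False
      then have card: "card (UNIV :: 'v set) = 6" using assms(4) by simp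
      obtain S\<^sub>1 S\<^sub>2 S\<^sub>3 where S: "S\<^sub>1 \<notin> \<Delta>" "S\<^sub>2 \<notin> \<Delta>" "S\<^sub>3 \<notin> \<Delta>"
        "card S\<^sub>1 = 2" "card S\<^sub>2 = 2" "card S\<^sub>3 = 2"
        "S\<^sub>1 \<inter> S\<^sub>2 = {}" "S\<^sub>1 \<inter> S\<^sub>3 = {}" "S\<^sub>2 \<inter> S\<^sub>3 = {}" "UNIV = S\<^sub>1 \<union> S\<^sub>2 \<union> S\<^sub>3"
        by (rule six_set_matching[OF card])
      obtain p\<^sub>1 q\<^sub>1 where 1: "S\<^sub>1 = {p\<^sub>1, q\<^sub>1}" "p\<^sub>1 \<noteq> q\<^sub>1" using S(4) by (auto simp: card_2_iff)
      obtain p\<^sub>2 q\<^sub>2 where 2: "S\<^sub>2 = {p\<^sub>2, q\<^sub>2}" "p\<^sub>2 \<noteq> q\<^sub>2" using S(5) by (auto simp: card_2_iff)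
      obtain p\<^sub>3 q\<^sub>3 where 3: "S\<^sub>3 = {p\<^sub>3, q\<^sub>3}" "p\<^sub>3 \<noteq> q\<^sub>3" using S(6) by (auto simp: card_2_iff)
      obtain T where T: "card T = 3" "clique T" "card (- T) = 3" "clique (- T)"
      proof (rule six_vertices_two_triangles)
        show "(UNIV :: 'v set) = {p\<^sub>1, q\<^sub>1, p\<^sub>2, q\<^sub>2, p\<^sub>3, q\<^sub>3}"
          unfolding S(10) 1(1) 2(1) 3(1) by auto
        show "distinct [p\<^sub>1, q\<^sub>1, p\<^sub>2, q\<^sub>2, p\<^sub>3, q\<^sub>3]"
          using S(7-9) 1(2) 2(2) 3(2) unfolding 1(1) 2(1) 3(1) by auto
      qed (use S(1-3) 1(1) 2(1) 3(1) in simp_all)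
      have "K \<in> triangles (one_skeleton \<Delta>)" if "card K = 3" "clique K" for K
        using that by (auto simp: triangles_def one_skeleton_def clique_def nonedge_def)
      then have "\<exists>T\<^sub>1\<in>triangles (one_skeleton \<Delta>). \<exists>T\<^sub>2\<in>triangles (one_skeleton \<Delta>). T\<^sub>1 \<inter> T\<^sub>2 = {}"
        using T by (intro bexI[of _ T] bexI[of _ "- T"]) simp_all
      moreover have "\<exists>e\<^sub>1\<in>complement_graph (one_skeleton \<Delta>). \<exists>e\<^sub>2\<in>complement_graph (one_skeleton \<Delta>).
        \<exists>e\<^sub>3\<in>complement_graph (one_skeleton \<Delta>). e\<^sub>1 \<inter> e\<^sub>2 = {} \<and> e\<^sub>1 \<inter> e\<^sub>3 = {} \<and> e\<^sub>2 \<inter> e\<^sub>3 = {}"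
        using S by (intro bexI[of _ S\<^sub>1] bexI[of _ S\<^sub>2] bexI[of _ S\<^sub>3]) (simp_all add: complement_iff)
      ultimately show ?thesis
        using card by blast
    qed
  next
    assume "?six \<or> ?seven"
    then show ?eq
    proof
      assume ?six
      then obtain e\<^sub>1 e\<^sub>2 e\<^sub>3 T\<^sub>1 T\<^sub>2 where card: "CARD('v) = 6"
        and e': "e\<^sub>1 \<in> complement_graph (one_skeleton \<Delta>)" "e\<^sub>2 \<in> complement_graph (one_skeleton \<Delta>)"
          "e\<^sub>3 \<in> complement_graph (one_skeleton \<Delta>)" "e\<^sub>1 \<inter> e\<^sub>2 = {}" "e\<^sub>1 \<inter> e\<^sub>3 = {}" "e\<^sub>2 \<inter> e\<^sub>3 = {}"
        and T: "T\<^sub>1 \<in> triangles (one_skeleton \<Delta>)" "T\<^sub>2 \<in> triangles (one_skeleton \<Delta>)" "T\<^sub>1 \<inter> T\<^sub>2 = {}"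
        by (elim conjE bexE)
      have e: "card e\<^sub>1 = 2" "e\<^sub>1 \<notin> \<Delta>" "card e\<^sub>2 = 2" "e\<^sub>2 \<notin> \<Delta>" "card e\<^sub>3 = 2" "e\<^sub>3 \<notin> \<Delta>"
        "e\<^sub>1 \<inter> e\<^sub>2 = {}" "e\<^sub>1 \<inter> e\<^sub>3 = {}" "e\<^sub>2 \<inter> e\<^sub>3 = {}"
        using e' by (simp_all add: complement_iff)
      have edge: "{u, v} \<in> \<Delta>" if "u \<in> T" "v \<in> T" "T \<in> triangles (one_skeleton \<Delta>)" for u v T
        using that vertex_face[of u] by (cases "u = v") (auto simp: triangles_def one_skeleton_def)
      \<comment> \<open>The two disjoint triangles exhaust the six vertices, as do the three
        disjoint nonedges below.\<close>
      have "card (T\<^sub>1 \<union> T\<^sub>2) = CARD('v)"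
        using T card by (simp add: card_Un_disjoint triangles_def)
      then have T_UNIV: "T\<^sub>1 \<union> T\<^sub>2 = UNIV"
        by (intro card_subset_eq) auto
      have "(e\<^sub>1 \<union> e\<^sub>2) \<inter> e\<^sub>3 = {}" using e(8,9) by blast
      then have "card (e\<^sub>1 \<union> e\<^sub>2 \<union> e\<^sub>3) = CARD('v)"
        using e card by (simp add: card_Un_disjoint)
      then have e_UNIV: "e\<^sub>1 \<union> e\<^sub>2 \<union> e\<^sub>3 = UNIV"
        by (intro card_subset_eq) auto
      \<comment> \<open>A nonedge cannot lie inside a triangle, so it runs between the two; this
        labels the pairs as \<open>packs_two_triangles\<close> expects.\<close>
      have split: "\<exists>p q. e = {p, q} \<and> p \<in> T\<^sub>1 \<and> q \<in> T\<^sub>2" if nonedge: "card e = 2" "e \<notin> \<Delta>" for e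
      proof -
        obtain u v where uv: "e = {u, v}" using nonedge(1) by (auto simp: card_2_iff)
        have "u \<in> T\<^sub>1 \<or> u \<in> T\<^sub>2" "v \<in> T\<^sub>1 \<or> v \<in> T\<^sub>2" using T_UNIV by blast+
        moreover have "\<not> (u \<in> T\<^sub>1 \<and> v \<in> T\<^sub>1)" "\<not> (u \<in> T\<^sub>2 \<and> v \<in> T\<^sub>2)"
          using edge T(1,2) nonedge(2) uv by blast+
        ultimately show ?thesis using uv by (metis insert_commute)
      qed
      obtain p\<^sub>1 q\<^sub>1 where 1: "e\<^sub>1 = {p\<^sub>1, q\<^sub>1}" "p\<^sub>1 \<in> T\<^sub>1" "q\<^sub>1 \<in> T\<^sub>2" using split[OF e(1,2)] by blast
      obtain p\<^sub>2 q\<^sub>2 where 2: "e\<^sub>2 = {p\<^sub>2, q\<^sub>2}" "p\<^sub>2 \<in> T\<^sub>1" "q\<^sub>2 \<in> T\<^sub>2" using split[OF e(3,4)] by blast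
      obtain p\<^sub>3 q\<^sub>3 where 3: "e\<^sub>3 = {p\<^sub>3, q\<^sub>3}" "p\<^sub>3 \<in> T\<^sub>1" "q\<^sub>3 \<in> T\<^sub>2" using split[OF e(5,6)] by blast
      have UNIV: "(UNIV :: 'v set) = {p\<^sub>1, p\<^sub>2, p\<^sub>3, q\<^sub>1, q\<^sub>2, q\<^sub>3}"
        unfolding e_UNIV[symmetric] 1(1) 2(1) 3(1) by auto
      have "p\<^sub>1 \<noteq> q\<^sub>1" "p\<^sub>2 \<noteq> q\<^sub>2" "p\<^sub>3 \<noteq> q\<^sub>3" using 1 2 3 T(3) by blast+
      then have dist: "distinct [p\<^sub>1, p\<^sub>2, p\<^sub>3, q\<^sub>1, q\<^sub>2, q\<^sub>3]"
        using e(7-9) unfolding 1(1) 2(1) 3(1) by auto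
      show ?eq
        unfolding eq_iff
      proof (intro allI impI)
        fix a :: "'v \<Rightarrow> nat"
        assume "\<forall>F\<in>\<Delta>. 3 \<le> sum a (- F)"
        then show "packs (- \<Delta>) 3 a"
          using 1 2 3 e(2,4,6) T(1,2)
          by (intro packs_two_triangles[OF UNIV dist]) (simp_all add: edge)
      qed
    next
      assume ?seven
      then obtain x :: "nat \<Rightarrow> 'v" where x: "bij_betw x {1..7} UNIV"
        and ideal: "(stanley_reisner_ideal \<Delta> :: ('v, 'k) mpoly set) =
              ideal.span {var (x 1) * var (x 2), var (x 2) * var (x 3), var (x 3) * var (x 4),
                var (x 4) * var (x 5), var (x 5) * var (x 6), var (x 6) * var (x 7),
                var (x 7) * var (x 1)}"
        by blast
      have inj: "inj_on x {1..7}" and image: "x ` {1..7} = UNIV"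
        using x by (auto simp: bij_betw_def)
      have nonfaces: "S \<notin> \<Delta> \<longleftrightarrow> (\<exists>e\<in>{{x 1, x 2}, {x 2, x 3}, {x 3, x 4}, {x 4, x 5}, {x 5, x 6}, {x 6, x 7}, {x 7, x 1}}. e \<subseteq> S)" for S
        using ideal unfolding squarefree_ideal_heptagon[OF inj, symmetric] ideal_iff by (rule spec)
      have seven: "{1..7::nat} = {1, 2, 3, 4, 5, 6, 7}" by auto
      have UNIV: "(UNIV :: 'v set) = {x 1, x 2, x 3, x 4, x 5, x 6, x 7}"
        unfolding image[symmetric] seven by simp
      have dist: "distinct [x 1, x 2, x 3, x 4, x 5, x 6, x 7]"
        using inj by (simp add: inj_on_eq_iff)
      show ?eq
        unfolding eq_iff using packs_heptagon[OF UNIV dist nonfaces] by blast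
    qed
  qed
qed

end
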